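(* Let $g\ge 3$ be an odd positive integer and let $G$ be an extra-special group of order $2^{2g+1}$. The number $N_g^{\circ}(G)$ of admissible epimorphisms $\varphi\colon\mathsf{B}_2(\Sigma_g)\to G$, up to automorphisms of $G$, is given by $$N_g^{\circ}(G)=\frac{1}{|\operatorname{Aut}(G)|}N_g(G)=2^{2g-1}(2^{2g}-1),$$ where $N_g(G)$ is the total number of admissible epimorphisms $\mathsf{B}_2(\Sigma_g)\to G$. In particular, $N_g^{\circ}(G)$ is independent of $G$ (i.e. it depends only on $g$ and not on the isomorphism class of the extra-special group $G$ of order $2^{2g+1}$).
   Context: Commutators are $[x,y]=xyx^{-1}y^{-1}$. Let $\Sigma_g$ be a compact Riemann surface of genus $g$. The full braid group on two strings $\mathsf{B}_2(\Sigma_g)\simeq\pi_1(\operatorname{Sym}^2\Sigma_g-\delta)$ (with $\delta$ the diagonal) is the group generated by $a_1,b_1,\dots,a_g,b_g,\sigma$ subject to the relations: $[a_i,\sigma^{-1}a_i\sigma^{-1}]=1$ and $[b_i,\sigma^{-1}b_i\sigma^{-1}]=1$ for $1\le i\le g$; $[a_i,\sigma^{-1}a_j\sigma]=[a_i,\sigma^{-1}b_j\sigma]=[b_i,\sigma^{-1}a_j\sigma]=[b_i,\sigma^{-1}b_j\sigma]=1$ for $j<i$; $[a_i,\sigma^{-1}b_i\sigma^{-1}]=\sigma^2$ for $1\le i\le g$; and $[a_1,b_1^{-1}]\cdots[a_g,b_g^{-1}]=\sigma^2$. For a finite group $G$, a group epimorphism $\varphi\colon\mathsf{B}_2(\Sigma_g)\to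 G$ is called admissible if $\varphi(\sigma)$ has order $n\ge 2$ (i.e. $\varphi(\sigma)\neq 1$). $N_g^{\circ}(G)$ is the number of orbits of $\operatorname{Aut}(G)$ acting by post-composition on the set of admissible epimorphisms $\mathsf{B}_2(\Sigma_g)\to G$. A finite $p$-group $G$ is extra-special if its center $Z(G)$ is cyclic of order $p$ and $G/Z(G)$ is a nontrivial elementary abelian $p$-group. *)

theory Defs
  imports "HOL-Algebra.Algebra" "HOL-Computational_Algebra.Primes"
begin

section \<open>Groups given by generators and relations\<close>

text \<open>The letter \<^term>\<open>(x, True)\<close> stands for the generator \<open>x\<close>, and
  \<^term>\<open>(x, False)\<close> for its formal inverse. A relation \<open>r = s\<close> is a pair \<^term>\<open>(r, s)\<close> of words.\<close>

type_synonym 'x gword = "('x \<times> bool) list"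

definition gwords :: "'x set \<Rightarrow> 'x gword set" where
  "gwords S = lists (S \<times> UNIV)"

definition gword_inv :: "'x gword \<Rightarrow> 'x gword" where
  "gword_inv w = rev (map (\<lambda>(x, e). (x, \<not> e)) w)"

definition gword_comm :: "'x gword \<Rightarrow> 'x gword \<Rightarrow> 'x gword" where
  "gword_comm v w = v @ w @ gword_inv v @ gword_inv w"

inductive_set pres_rel :: "'x set \<Rightarrow> ('x gword \<times> 'x gword) set \<Rightarrow> ('x gword \<times> 'x gword) set"
  for S :: "'x set" and R :: "('x gword \<times> 'x gword) set" where
  refl: "w \<in> gwords S \<Longrightarrow> (w, w) \<in> pres_rel S R"
| sym: "(v, w) \<in> pres_rel S R \<Longrightarrow> (w, v) \<in> pres_rel S R"
| trans: "(u, v) \<in> pres_rel S R \<Longrightarrow> (v, w) \<in> pres_rel S R \<Longrightarrow> (u, w) \<in> pres_rel S R"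
| cancel: "u \<in> gwords S \<Longrightarrow> v \<in> gwords S \<Longrightarrow> x \<in> S
    \<Longrightarrow> (u @ [(x, e), (x, \<not> e)] @ v, u @ v) \<in> pres_rel S R"
| relation: "u \<in> gwords S \<Longrightarrow> v \<in> gwords S \<Longrightarrow> r \<in> gwords S \<Longrightarrow> s \<in> gwords S \<Longrightarrow> (r, s) \<in> R
    \<Longrightarrow> (u @ r @ v, u @ s @ v) \<in> pres_rel S R"

definition pres_class :: "'x set \<Rightarrow> ('x gword \<times> 'x gword) set \<Rightarrow> 'x gword \<Rightarrow> 'x gword set" where
  "pres_class S R w = pres_rel S R `` {w}"

definition presented_group ::
    "'x set \<Rightarrow> ('x gword \<times> 'x gword) set \<Rightarrow> 'x gword set monoid" where
  "presented_group S R =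
    \<lparr>carrier = gwords S // pres_rel S R,
     monoid.mult = (\<lambda>C D. \<Union>v\<in>C. \<Union>w\<in>D. pres_class S R (v @ w)),
     one = pres_class S R []\<rparr>"

lemma gwords_append [simp]: "v @ w \<in> gwords S \<longleftrightarrow> v \<in> gwords S \<and> w \<in> gwords S"
  by (auto simp: gwords_def)

lemma gwords_Nil [simp]: "[] \<in> gwords S"
  by (simp add: gwords_def)

lemma gwords_inv: "w \<in> gwords S \<Longrightarrow> gword_inv w \<in> gwords S"
  by (auto simp: gwords_def gword_inv_def)

lemma pres_rel_gwords: "(v, w) \<in> pres_rel S R \<Longrightarrow> v \<in> gwords S \<and> w \<in> gwords S"
  by (induction rule: pres_rel.induct) (simp_all, simp_all add: gwords_def)

lemma equiv_pres_rel: "equiv (gwords S) (pres_rel S R)"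
proof (rule equivI)
  show "pres_rel S R \<subseteq> gwords S \<times> gwords S" using pres_rel_gwords by fast
  show "refl_on (gwords S) (pres_rel S R)" by (simp add: refl_on_def pres_rel.refl)
  show "sym_on UNIV (pres_rel S R)" by (rule symI) (rule pres_rel.sym)
  show "trans_on UNIV (pres_rel S R)" by (rule transI) (rule pres_rel.trans)
qed

lemma pres_rel_extend:
  "(v, w) \<in> pres_rel S R \<Longrightarrow> a \<in> gwords S \<Longrightarrow> b \<in> gwords S
    \<Longrightarrow> (a @ v @ b, a @ w @ b) \<in> pres_rel S R"
proof (induction rule: pres_rel.induct)
  case (cancel u v x e)
  then show ?case using pres_rel.cancel[of "a @ u" S "v @ b" x e R] by simp
next
  case (relation u v r s)
  then show ?case using pres_rel.relation[of "a @ u" S "v @ b" r s R] by simp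
next
  case (sym v w)
  then show ?case using pres_rel.sym by blast
next
  case (trans u v w)
  then show ?case using pres_rel.trans by blast
qed (simp add: pres_rel.refl)

lemma pres_rel_append:
  assumes "(v, v') \<in> pres_rel S R" "(w, w') \<in> pres_rel S R"
  shows "(v @ w, v' @ w') \<in> pres_rel S R"
  using pres_rel_extend[OF assms(1), of "[]" w] pres_rel_extend[OF assms(2), of v' "[]"]
    assms[THEN pres_rel_gwords] pres_rel.trans[of "v @ w" "v' @ w" S R "v' @ w'"] by simp

lemma pres_rel_inv: "w \<in> gwords S \<Longrightarrow> (gword_inv w @ w, []) \<in> pres_rel S R"
proof (induction w)
  case Nil
  then show ?case by (simp add: gword_inv_def pres_rel.refl)
next
  case (Cons l w)
  obtain x e where l: "l = (x, e)" by force
  have w: "w \<in> gwords S" and x: "x \<in> S" using Cons.prems l by (auto simp: gwords_def)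
  have "(gword_inv w @ [(x, \<not> e), (x, \<not> \<not> e)] @ w, gword_inv w @ w) \<in> pres_rel S R"
    using pres_rel.cancel[OF gwords_inv[OF w] w x, of "\<not> e"] .
  then have "(gword_inv (l # w) @ l # w, gword_inv w @ w) \<in> pres_rel S R"
    using l by (simp add: gword_inv_def)
  then show ?case using Cons.IH[OF w] by (rule pres_rel.trans)
qed

lemma pres_class_eq_iff:
  "v \<in> gwords S \<Longrightarrow> w \<in> gwords S
    \<Longrightarrow> pres_class S R v = pres_class S R w \<longleftrightarrow> (v, w) \<in> pres_rel S R"
  unfolding pres_class_def by (rule eq_equiv_class_iff[OF equiv_pres_rel])

lemma presented_group_carrier:
  "carrier (presented_group S R) = pres_class S R ` gwords S"
  by (auto simp: presented_group_def quotient_def pres_class_def)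

lemma presented_group_mult:
  assumes "v \<in> gwords S" "w \<in> gwords S"
  shows "pres_class S R v \<otimes>\<^bsub>presented_group S R\<^esub> pres_class S R w = pres_class S R (v @ w)"
proof -
  have eq: "pres_class S R (v' @ w') = pres_class S R (v @ w)"
    if "v' \<in> pres_class S R v" "w' \<in> pres_class S R w" for v' w'
  proof -
    have r: "(v, v') \<in> pres_rel S R" "(w, w') \<in> pres_rel S R"
      using that by (auto simp: pres_class_def)
    show ?thesis
      using pres_rel.sym[OF pres_rel_append[OF r]] r[THEN pres_rel_gwords]
      by (simp add: pres_class_eq_iff)
  qed
  have "pres_class S R v \<noteq> {}" "pres_class S R w \<noteq> {}"
    using assms pres_rel.refl by (force simp: pres_class_def)+
  moreover have "(\<Union>v'\<in>pres_class S R v. \<Union>w'\<in>pres_class S R w. pres_class S R (v' @ w'))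
      = (\<Union>v'\<in>pres_class S R v. \<Union>w'\<in>pres_class S R w. pres_class S R (v @ w))"
    by (intro SUP_cong HOL.refl eq)
  ultimately show ?thesis by (simp add: presented_group_def)
qed

lemma presented_group_one: "\<one>\<^bsub>presented_group S R\<^esub> = pres_class S R []"
  by (simp add: presented_group_def)

lemma group_presented_group: "group (presented_group S R)"
proof (rule groupI)
  fix C D assume "C \<in> carrier (presented_group S R)" "D \<in> carrier (presented_group S R)"
  then show "C \<otimes>\<^bsub>presented_group S R\<^esub> D \<in> carrier (presented_group S R)"
    by (auto simp: presented_group_carrier presented_group_mult)
next
  show "\<one>\<^bsub>presented_group S R\<^esub> \<in> carrier (presented_group S R)"
    by (simp add: presented_group_carrier presented_group_one)
next
  fix C D E assume "C \<in> carrier (presented_group S R)" "D \<in> carrier (presented_group S R)"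
    "E \<in> carrier (presented_group S R)"
  then show "C \<otimes>\<^bsub>presented_group S R\<^esub> D \<otimes>\<^bsub>presented_group S R\<^esub> E
      = C \<otimes>\<^bsub>presented_group S R\<^esub> (D \<otimes>\<^bsub>presented_group S R\<^esub> E)"
    by (auto simp: presented_group_carrier presented_group_mult)
next
  fix C assume "C \<in> carrier (presented_group S R)"
  then obtain w where w: "w \<in> gwords S" "C = pres_class S R w"
    by (auto simp: presented_group_carrier)
  show "\<one>\<^bsub>presented_group S R\<^esub> \<otimes>\<^bsub>presented_group S R\<^esub> C = C"
    using w by (simp add: presented_group_one presented_group_mult)
  have "pres_class S R (gword_inv w) \<in> carrier (presented_group S R)"
    using gwords_inv[OF w(1)] by (simp add: presented_group_carrier)
  moreover have "pres_class S R (gword_inv w) \<otimes>\<^bsub>presented_group S R\<^esub> C = \<one>\<^bsub>presented_group S R\<^esub>"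
    using w pres_rel_inv[OF w(1), of R] gwords_inv[OF w(1)]
    by (simp add: presented_group_one presented_group_mult pres_class_eq_iff)
  ultimately show "\<exists>D\<in>carrier (presented_group S R). D \<otimes>\<^bsub>presented_group S R\<^esub> C = \<one>\<^bsub>presented_group S R\<^esub>"
    by blast
qed


section \<open>The braid group on two strings of a closed surface\<close>

datatype braid_gen = GenA nat | GenB nat | GenS

definition braid_gens :: "nat \<Rightarrow> braid_gen set" where
  "braid_gens g = GenA ` {1..g} \<union> GenB ` {1..g} \<union> {GenS}"

abbreviation wa :: "nat \<Rightarrow> braid_gen gword" where "wa i \<equiv> [(GenA i, True)]"
abbreviation wb :: "nat \<Rightarrow> braid_gen gword" where "wb i \<equiv> [(GenB i, True)]"
abbreviation ws :: "braid_gen gword" where "ws \<equiv> [(GenS, True)]"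
abbreviation ws' :: "braid_gen gword" where "ws' \<equiv> [(GenS, False)]"

definition braid_rels :: "nat \<Rightarrow> (braid_gen gword \<times> braid_gen gword) set" where
  "braid_rels g =
     (\<Union>i\<in>{1..g}.
        {(gword_comm (wa i) (ws' @ wa i @ ws'), []),
         (gword_comm (wb i) (ws' @ wb i @ ws'), [])})
   \<union> (\<Union>i\<in>{1..g}. \<Union>j\<in>{1..<i}.
        {(gword_comm (wa i) (ws' @ wa j @ ws), []),
         (gword_comm (wa i) (ws' @ wb j @ ws), []),
         (gword_comm (wb i) (ws' @ wa j @ ws), []),
         (gword_comm (wb i) (ws' @ wb j @ ws), [])})
   \<union> (\<Union>i\<in>{1..g}. {(gword_comm (wa i) (ws' @ wb i @ ws'), ws @ ws)})
   \<union> {(concat (map (\<lambda>i. gword_comm (wa i) (gword_inv (wb i))) [1..<Suc g]), ws @ ws)}"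

definition braid2 :: "nat \<Rightarrow> braid_gen gword set monoid" where
  "braid2 g = presented_group (braid_gens g) (braid_rels g)"

definition braid2_sigma :: "nat \<Rightarrow> braid_gen gword set" where
  "braid2_sigma g = pres_class (braid_gens g) (braid_rels g) ws"


section \<open>Admissible epimorphisms\<close>

text \<open>As in \<^const>\<open>Bij\<close>, maps are taken to be \<^const>\<open>extensional\<close>: HOL functions
  that differ only outside the carrier must not be counted twice.\<close>

definition admissible_epis :: "nat \<Rightarrow> 'a monoid \<Rightarrow> (braid_gen gword set \<Rightarrow> 'a) set" where
  "admissible_epis g G =
     {f \<in> epi (braid2 g) G \<inter> extensional (carrier (braid2 g)).
        group.ord G (f (braid2_sigma g)) \<ge> 2}"

definition post_compose ::
    "nat \<Rightarrow> 'a monoid \<Rightarrow> ('a \<Rightarrow> 'a) \<Rightarrow> (braid_gen gword set \<Rightarrow> 'a) \<Rightarrow> braid_gen gword set \<Rightarrow> 'a" where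
  "post_compose g G \<alpha> = (\<lambda>f\<in>admissible_epis g G. compose (carrier (braid2 g)) \<alpha> f)"

definition num_admissible :: "nat \<Rightarrow> 'a monoid \<Rightarrow> nat" where
  "num_admissible g G = card (admissible_epis g G)"

definition num_admissible_upto_aut :: "nat \<Rightarrow> 'a monoid \<Rightarrow> nat" where
  "num_admissible_upto_aut g G =
     card (orbits (AutoGroup G) (admissible_epis g G) (post_compose g G))"


section \<open>Extra-special groups\<close>

definition center :: "('a, 'b) monoid_scheme \<Rightarrow> 'a set" where
  "center G = {z \<in> carrier G. \<forall>x\<in>carrier G. z \<otimes>\<^bsub>G\<^esub> x = x \<otimes>\<^bsub>G\<^esub> z}"

definition finite_p_group :: "nat \<Rightarrow> ('a, 'b) monoid_scheme \<Rightarrow> bool" where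
  "finite_p_group p G \<longleftrightarrow> group G \<and> finite (carrier G) \<and> (\<exists>k. order G = p ^ k)"

definition elementary_abelian :: "nat \<Rightarrow> ('a, 'b) monoid_scheme \<Rightarrow> bool" where
  "elementary_abelian p G \<longleftrightarrow> comm_group G \<and> (\<forall>x\<in>carrier G. x [^]\<^bsub>G\<^esub> p = \<one>\<^bsub>G\<^esub>)"

definition extra_special :: "'a monoid \<Rightarrow> bool" where
  "extra_special G \<longleftrightarrow> (\<exists>p. Factorial_Ring.prime p \<and> finite_p_group p G
     \<and> cyclic_group (G\<lparr>carrier := center G\<rparr>) \<and> card (center G) = p
     \<and> elementary_abelian p (G Mod center G) \<and> \<not> trivial_group (G Mod center G))"

end

theory Submission
  imports Defs
begin

text \<open>
  Let \<open>Z(G) = {1, z}\<close>. Commutators and squares in \<open>G\<close> are central, so they define on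
  \<open>V = G / Z(G)\<close>, a space of dimension \<open>2g\<close> over the field with two elements, a nondegenerate
  alternating form \<open>\<omega>\<close>, where \<open>[x, y] = z\<^sup>\<omega>\<close>, and a quadratic form \<open>q\<close> that polarizes to it,
  where \<open>x x = z\<^sup>q\<close>.

  Conjugation only changes an element by a central factor. The mixed relations of the braid group
  therefore say that the images of generators of different handles commute, and the relation
  \<open>[a\<^sub>i, \<sigma>\<inverse> b\<^sub>i \<sigma>\<inverse>] = \<sigma>\<^sup>2\<close> says that \<open>\<sigma>\<^sup>2 = [a\<^sub>i, b\<^sub>i]\<close>. If \<open>\<sigma>\<^sup>2 = 1\<close>, then all
  \<open>a\<^sub>i\<close> and \<open>b\<^sub>i\<close> commute and the image of the braid group is too small for surjectivity
  (\<open>isotropic_not_generating\<close>). Hence \<open>\<sigma>\<^sup>2 = z\<close>, and the \<open>a\<^sub>i, b\<^sub>i\<close> lift a symplectic basis of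
  \<open>V\<close>. Conversely such a choice satisfies all relations, the surface relation because \<open>g\<close> is odd
  and so \<open>z\<^sup>g = z\<close>, and it generates \<open>G\<close>. An admissible epimorphism is thus a lifted symplectic
  basis together with an arbitrary \<open>\<sigma>\<close> of order four.

  Both factors are counted through the Arf invariant. The squares of the members of a lifted
  symplectic basis form a vector \<open>\<epsilon>\<close> of \<open>2g\<close> bits. Two bases with the same \<open>\<epsilon>\<close> are related by
  exactly one automorphism of \<open>G\<close> (\<open>automorphism_extending\<close>), since \<open>\<epsilon>\<close> and \<open>\<omega>\<close> determine the
  multiplication table. The vectors \<open>\<epsilon>\<close> that occur are those with the same Arf invariant \<open>c\<close> as
  any one of them: a transvection along a vector \<open>t\<close> with \<open>q(t) = 0\<close> moves from one to another
  (\<open>symplectic_transvection\<close>). So there are \<open>|Aut G|\<close> times the number of bit vectors with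
  invariant \<open>c\<close> lifted bases. The value of \<open>q\<close> at a vector is the change of the Arf invariant that
  the vector causes when it is added to \<open>\<epsilon>\<close> (\<open>nontrivial_square_arf\<close>), so there are as many vectors with
  \<open>q = 1\<close> as bit vectors whose invariant is not \<open>c\<close>, and each has two lifts. The numbers of bit
  vectors with the two invariants are \<open>2\<^bsup>g-1\<^esup>(2\<^sup>g + 1)\<close> and \<open>2\<^bsup>g-1\<^esup>(2\<^sup>g - 1)\<close>; only their product
  enters, and this is why the answer is the same for both isomorphism types of \<open>G\<close>.

  Finally \<open>Aut G\<close> acts freely on epimorphisms, so that the number of orbits is the quotient by
  \<open>|Aut G|\<close>.
\<close>

section \<open>Homomorphisms out of a presented group\<close>

definition word_value :: "('a, 'b) monoid_scheme \<Rightarrow> ('x \<Rightarrow> 'a) \<Rightarrow> 'x gword \<Rightarrow> 'a" where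
  "word_value G x w =
     foldr (\<lambda>(s, e) y. (if e then x s else inv\<^bsub>G\<^esub> (x s)) \<otimes>\<^bsub>G\<^esub> y) w \<one>\<^bsub>G\<^esub>"

lemma word_value_Nil [simp]: "word_value G x [] = \<one>\<^bsub>G\<^esub>"
  by (simp add: word_value_def)

lemma word_value_Cons [simp]:
  "word_value G x ((s, e) # w) = (if e then x s else inv\<^bsub>G\<^esub> (x s)) \<otimes>\<^bsub>G\<^esub> word_value G x w"
  by (simp add: word_value_def)

lemma gwords_Cons [simp]: "(s, e) # w \<in> gwords S \<longleftrightarrow> s \<in> S \<and> w \<in> gwords S"
  by (auto simp: gwords_def)

lemma word_value_cong:
  "w \<in> gwords S \<Longrightarrow> (\<And>s. s \<in> S \<Longrightarrow> x s = y s) \<Longrightarrow> word_value G x w = word_value G y w"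
  by (induction w) auto

lemma pres_class_in_carrier: "w \<in> gwords S \<Longrightarrow> pres_class S R w \<in> carrier (presented_group S R)"
  by (simp add: presented_group_carrier)

context group
begin

lemma word_value_closed [simp]:
  "w \<in> gwords S \<Longrightarrow> x \<in> S \<rightarrow> carrier G \<Longrightarrow> word_value G x w \<in> carrier G"
  by (induction w) (auto simp: Pi_iff)

lemma word_value_append:
  "v \<in> gwords S \<Longrightarrow> w \<in> gwords S \<Longrightarrow> x \<in> S \<rightarrow> carrier G
    \<Longrightarrow> word_value G x (v @ w) = word_value G x v \<otimes> word_value G x w"
proof (induction v)
  case (Cons l v)
  then show ?case
    by (cases l) (use word_value_closed[of v S x] word_value_closed[of w S x] in
        \<open>auto simp: m_assoc Pi_iff\<close>)
qed (use word_value_closed[of w S x] in auto)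

lemma word_value_gword_inv:
  assumes "w \<in> gwords S" "x \<in> S \<rightarrow> carrier G"
  shows "word_value G x (gword_inv w) = inv (word_value G x w)"
  using assms
proof (induction w)
  case (Cons l w)
  obtain s e where l: "l = (s, e)" by force
  have s: "s \<in> S" "x s \<in> carrier G" and w: "w \<in> gwords S"
    using Cons.prems l by (auto simp: Pi_iff)
  have "word_value G x (gword_inv w @ [(s, \<not> e)])
      = word_value G x (gword_inv w) \<otimes> word_value G x [(s, \<not> e)]"
    using Cons.prems s w by (intro word_value_append[of _ S]) (auto simp: gwords_inv)
  moreover have "word_value G x (gword_inv w) = inv (word_value G x w)"
    using Cons.IH w Cons.prems by blast
  ultimately show ?case
    using s w Cons.prems(2) word_value_closed[of w S x]
    by (auto simp: l gword_inv_def inv_mult_group)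
qed (simp add: gword_inv_def)

lemma hom_word_value:
  assumes "group H" and f: "f \<in> hom G H" and x: "x \<in> S \<rightarrow> carrier G" and w: "w \<in> gwords S"
  shows "f (word_value G x w) = word_value H (\<lambda>j. f (x j)) w"
proof -
  interpret f: group_hom G H f
    using assms(1) f by (simp add: group_hom_def group_hom_axioms_def is_group)
  show ?thesis using w
  proof (induction w)
    case (Cons l w)
    obtain s e where l: "l = (s, e)" by force
    have s: "x s \<in> carrier G" and w: "w \<in> gwords S" using Cons.prems l x by auto
    show ?case using Cons.IH[OF w] l s word_value_closed[OF w x] by simp
  qed simp
qed

lemma auto_inject:
  assumes "\<alpha> \<in> auto G" "x \<in> carrier G" "y \<in> carrier G"
  shows "\<alpha> x = \<alpha> y \<longleftrightarrow> x = y"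
  using assms by (auto simp: auto_def Bij_def bij_betw_def inj_on_def)

lemma word_value_pres_rel:
  assumes "x \<in> S \<rightarrow> carrier G"
    and rel: "\<And>r s. (r, s) \<in> R \<Longrightarrow> word_value G x r = word_value G x s"
    and "(v, w) \<in> pres_rel S R"
  shows "word_value G x v = word_value G x w"
  using assms(3)
proof (induction rule: pres_rel.induct)
  case (cancel u v s e)
  then have "x s \<in> carrier G" using assms(1) by (auto simp: Pi_iff)
  moreover have "word_value G x ([(s, e), (s, \<not> e)] @ v) = word_value G x v"
    using cancel calculation assms(1) word_value_closed[of v S x]
    by (auto simp flip: m_assoc)
  ultimately show ?case
    using cancel assms(1) word_value_append[of u S "[(s, e), (s, \<not> e)] @ v" x]
      word_value_append[of u S v x] by simp
next
  case (relation u v r s)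
  then show ?case
    using assms(1) rel[of r s] by (simp add: word_value_append[of _ S])
qed auto

lemma hom_presented_group_value:
  assumes f: "f \<in> hom (presented_group S R) G" and w: "w \<in> gwords S"
  shows "f (pres_class S R w) = word_value G (\<lambda>s. f (pres_class S R [(s, True)])) w"
proof -
  let ?P = "presented_group S R"
  interpret f: group_hom ?P G f
    using f by (simp add: group_hom_def group_hom_axioms_def group_presented_group is_group)
  show ?thesis using w
  proof (induction w)
    case Nil
    then show ?case using f.hom_one by (simp add: presented_group_one)
  next
    case (Cons l w)
    obtain s e where l: "l = (s, e)" by force
    have s: "s \<in> S" and w: "w \<in> gwords S" using Cons.prems l by auto
    let ?p = "pres_class S R [(s, True)]"
    have p: "?p \<in> carrier ?P" using s by (intro pres_class_in_carrier) simp
    have "pres_class S R [(s, False)] \<otimes>\<^bsub>?P\<^esub> ?p = \<one>\<^bsub>?P\<^esub>"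
      using s pres_rel.cancel[of "[]" S "[]" s False R]
      by (simp add: presented_group_mult presented_group_one pres_class_eq_iff)
    then have "pres_class S R [(s, False)] = inv\<^bsub>?P\<^esub> ?p"
      using s p by (intro f.G.inv_equality[symmetric] pres_class_in_carrier) auto
    then have "f (pres_class S R [(s, e)]) = (if e then f ?p else inv (f ?p))"
      using p by (cases e) auto
    moreover have "pres_class S R (l # w) = pres_class S R [(s, e)] \<otimes>\<^bsub>?P\<^esub> pres_class S R w"
      using s w l by (simp add: presented_group_mult)
    ultimately show ?case
      using Cons.IH[OF w] s w l by (simp add: f.hom_mult pres_class_in_carrier)
  qed
qed

text \<open>Von Dyck's theorem, as a bijection that can be used for counting. In the inverse
  direction, a class is sent to the value of any word in it.\<close>

theorem bij_betw_hom_presented_group: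
  assumes R: "\<And>r s. (r, s) \<in> R \<Longrightarrow> r \<in> gwords S \<and> s \<in> gwords S"
  shows "bij_betw (\<lambda>f. \<lambda>s\<in>S. f (pres_class S R [(s, True)]))
    (hom (presented_group S R) G \<inter> extensional (carrier (presented_group S R)))
    {x \<in> S \<rightarrow>\<^sub>E carrier G. \<forall>(r, s)\<in>R. word_value G x r = word_value G x s}"
    (is "bij_betw ?ev ?F ?X")
proof -
  let ?P = "presented_group S R"
  have ev: "word_value G (?ev f) w = f (pres_class S R w)" if "f \<in> ?F" "w \<in> gwords S" for f w
    using that hom_presented_group_value[of f S R w]
      word_value_cong[of w S "?ev f" "\<lambda>s. f (pres_class S R [(s, True)])" G] by simp
  have "inj_on ?ev ?F"
  proof (rule inj_onI)
    fix f h assume fh: "f \<in> ?F" "h \<in> ?F" "?ev f = ?ev h"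
    show "f = h"
    proof (rule extensionalityI[of _ "carrier ?P"])
      fix C assume "C \<in> carrier ?P"
      then obtain w where w: "w \<in> gwords S" "C = pres_class S R w"
        by (auto simp: presented_group_carrier)
      have "f C = word_value G (?ev f) w" using ev[OF fh(1) w(1)] w(2) by simp
      also have "\<dots> = h C" unfolding fh(3) using ev[OF fh(2) w(1)] w(2) by simp
      finally show "f C = h C" .
    qed (use fh in auto)
  qed
  moreover have "?ev ` ?F \<subseteq> ?X"
  proof
    fix x assume "x \<in> ?ev ` ?F"
    then obtain f where f: "f \<in> ?F" "x = ?ev f" by blast
    have "f (pres_class S R [(s, True)]) \<in> carrier G" if "s \<in> S" for s
      using f(1) that by (auto simp: hom_def Pi_iff intro!: pres_class_in_carrier)
    moreover have "word_value G x r = word_value G x s" if rs: "(r, s) \<in> R" for r s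
    proof -
      have "(r, s) \<in> pres_rel S R"
        using pres_rel.relation[of "[]" S "[]" r s R] R[OF rs] rs by simp
      then have "pres_class S R r = pres_class S R s"
        using R[OF rs] pres_class_eq_iff[of r S s R] by blast
      then show ?thesis
        using ev[OF f(1), of r] ev[OF f(1), of s] R[OF rs] unfolding f(2) by simp
    qed
    ultimately show "x \<in> ?X" using f(2) by auto
  qed
  moreover have "?X \<subseteq> ?ev ` ?F"
  proof
    fix x assume x: "x \<in> ?X"
    then have x': "x \<in> S \<rightarrow> carrier G" by auto
    have rel: "word_value G x r = word_value G x s" if "(r, s) \<in> R" for r s
      using x that by auto
    define f where "f = (\<lambda>C\<in>carrier ?P. word_value G x (SOME w. w \<in> gwords S \<and> pres_class S R w = C))"
    have f: "f (pres_class S R w) = word_value G x w" if w: "w \<in> gwords S" for w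
    proof -
      define v where "v = (SOME v. v \<in> gwords S \<and> pres_class S R v = pres_class S R w)"
      have v: "v \<in> gwords S \<and> pres_class S R v = pres_class S R w"
        unfolding v_def by (rule someI[of _ w]) (simp add: w)
      have "(v, w) \<in> pres_rel S R"
        using iffD1[OF pres_class_eq_iff[OF conjunct1[OF v] w] conjunct2[OF v]] .
      then have "word_value G x v = word_value G x w"
        using word_value_pres_rel[OF x' rel, of R v w] by blast
      moreover have "f (pres_class S R w) = word_value G x v"
        unfolding f_def v_def using w by (simp only: restrict_apply' pres_class_in_carrier)
      ultimately show ?thesis by simp
    qed
    have "f \<in> hom ?P G"
    proof (rule homI)
      fix C assume "C \<in> carrier ?P"
      then obtain w where "w \<in> gwords S" "C = pres_class S R w"
        by (auto simp: presented_group_carrier)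
      then show "f C \<in> carrier G" by (simp add: f word_value_closed[OF _ x'])
    next
      fix C D assume "C \<in> carrier ?P" "D \<in> carrier ?P"
      then obtain v w where "v \<in> gwords S" "w \<in> gwords S" "C = pres_class S R v" "D = pres_class S R w"
        by (auto simp: presented_group_carrier)
      then show "f (C \<otimes>\<^bsub>?P\<^esub> D) = f C \<otimes> f D"
        by (simp add: f presented_group_mult word_value_append[OF _ _ x'])
    qed
    moreover have "f \<in> extensional (carrier ?P)" by (simp add: f_def)
    moreover have "x = ?ev f"
    proof (rule extensionalityI[of _ S])
      fix s assume "s \<in> S"
      then show "x s = ?ev f s" using x' by (simp add: f Pi_iff)
    qed (use x in \<open>auto simp: PiE_iff\<close>)
    ultimately show "x \<in> ?ev ` ?F" by blast
  qed
  ultimately show ?thesis by (auto simp: bij_betw_def)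
qed

end

section \<open>The Arf invariant of a bit vector\<close>

text \<open>The letters of the surface generators index the coordinates: a subset of
  \<open>handle_gens n\<close> is a vector over the field with two elements, \<open>sym_diff\<close> is addition, and
  \<open>dual\<close> exchanges the two letters of a handle.\<close>

definition handle_gens :: "nat \<Rightarrow> braid_gen set" where
  "handle_gens n = GenA ` {1..n} \<union> GenB ` {1..n}"

fun dual :: "braid_gen \<Rightarrow> braid_gen" where
  "dual (GenA i) = GenB i" | "dual (GenB i) = GenA i" | "dual GenS = GenS"

text \<open>As a function of a vector, this is the split quadratic form \<open>\<Sum>\<^sub>i a\<^sub>i b\<^sub>i\<close>; of the
  vector of values of a quadratic form on a symplectic basis, it is the Arf invariant.\<close>

definition arf :: "nat \<Rightarrow> braid_gen set \<Rightarrow> bool" where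
  "arf n S \<longleftrightarrow> odd (card {i \<in> {1..n}. GenA i \<in> S \<and> GenB i \<in> S})"

lemma finite_handle_gens [simp]: "finite (handle_gens n)"
  by (simp add: handle_gens_def)

lemma card_handle_gens: "card (handle_gens n) = 2 * n"
  unfolding handle_gens_def
  by (subst card_Un_disjoint) (auto simp: card_image inj_on_def)

lemma dual_dual [simp]: "dual (dual j) = j"
  by (cases j) auto

lemma dual_in_handle_gens [simp]: "dual j \<in> handle_gens n \<longleftrightarrow> j \<in> handle_gens n"
  by (cases j) (auto simp: handle_gens_def)

lemma handle_gens_Suc:
  "handle_gens (Suc n) = insert (GenA (Suc n)) (insert (GenB (Suc n)) (handle_gens n))"
  by (auto simp: handle_gens_def atLeastAtMostSuc_conv)

lemma arf_toggle:
  assumes "j \<in> handle_gens n"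
  shows "arf n (sym_diff S {j}) \<longleftrightarrow> (arf n S \<noteq> (dual j \<in> S))"
proof -
  obtain i where i: "i \<in> {1..n}" "j = GenA i \<or> j = GenB i"
    using assms by (auto simp: handle_gens_def)
  let ?P = "\<lambda>S. {k \<in> {1..n}. GenA k \<in> S \<and> GenB k \<in> S}"
  have other: "?P (sym_diff S {j}) - {i} = ?P S - {i}"
    using i(2) by auto
  have "odd (card (?P T)) \<longleftrightarrow> (odd (card (?P T - {i})) \<noteq> (GenA i \<in> T \<and> GenB i \<in> T))" for T
  proof (cases "i \<in> ?P T")
    case True
    moreover have "finite (?P T)" by simp
    ultimately show ?thesis
      using card_Suc_Diff1[of "?P T" i] by (metis (mono_tags, lifting) even_Suc mem_Collect_eq)
  next
    case False
    then show ?thesis using i(1) by simp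
  qed
  from this[of S] this[of "sym_diff S {j}"] show ?thesis
    unfolding arf_def other using i(2) by auto
qed

lemma card_subsets_insert:
  assumes "finite A" "a \<notin> A"
  shows "card {S \<in> Pow (insert a A). P S}
    = card {S \<in> Pow A. P S} + card {S \<in> Pow A. P (insert a S)}"
proof -
  have "{S \<in> Pow (insert a A). P S} = {S \<in> Pow A. P S} \<union> insert a ` {S \<in> Pow A. P (insert a S)}"
    by (auto simp: Pow_insert)
  moreover have "inj_on (insert a) {S \<in> Pow A. P (insert a S)}"
    using assms(2) by (intro inj_onI) (auto simp: insert_eq_iff)
  moreover have "{S \<in> Pow A. P S} \<inter> insert a ` {S \<in> Pow A. P (insert a S)} = {}"
    using assms(2) by auto
  ultimately show ?thesis using assms(1) by (simp add: card_Un_disjoint card_image)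
qed

lemma arf_card_step:
  assumes "S \<subseteq> handle_gens n"
  shows "arf (Suc n) S \<longleftrightarrow> arf n S"
    and "arf (Suc n) (insert (GenA (Suc n)) S) \<longleftrightarrow> arf n S"
    and "arf (Suc n) (insert (GenB (Suc n)) S) \<longleftrightarrow> arf n S"
    and "arf (Suc n) (insert (GenA (Suc n)) (insert (GenB (Suc n)) S)) \<longleftrightarrow> \<not> arf n S"
proof -
  have new: "GenA (Suc n) \<notin> S" "GenB (Suc n) \<notin> S" using assms by (auto simp: handle_gens_def)
  let ?P = "\<lambda>n S. {i \<in> {1..n}. GenA i \<in> S \<and> GenB i \<in> S}"
  have "?P (Suc n) T = ?P n S"
    if "T \<in> {S, insert (GenA (Suc n)) S, insert (GenB (Suc n)) S}" for T
    using that new by (auto simp: le_Suc_eq)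
  from this[of S] this[of "insert (GenA (Suc n)) S"] this[of "insert (GenB (Suc n)) S"]
  show "arf (Suc n) S \<longleftrightarrow> arf n S"
      "arf (Suc n) (insert (GenA (Suc n)) S) \<longleftrightarrow> arf n S"
      "arf (Suc n) (insert (GenB (Suc n)) S) \<longleftrightarrow> arf n S"
    unfolding arf_def by (simp_all only: insert_iff simp_thms)
  have "?P (Suc n) (insert (GenA (Suc n)) (insert (GenB (Suc n)) S)) = insert (Suc n) (?P n S)"
    by (auto simp: le_Suc_eq)
  moreover have "card (insert (Suc n) (?P n S)) = Suc (card (?P n S))" by simp
  ultimately show "arf (Suc n) (insert (GenA (Suc n)) (insert (GenB (Suc n)) S)) \<longleftrightarrow> \<not> arf n S"
    unfolding arf_def by simp
qed

lemma card_sym_diff_sets: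
  assumes "E \<subseteq> H"
  shows "card {T \<in> Pow H. P (sym_diff T E)} = card {T \<in> Pow H. P T}"
proof (rule bij_betw_same_card)
  have "sym_diff (sym_diff T E) E = T" for T by blast
  then show "bij_betw (\<lambda>T. sym_diff T E) {T \<in> Pow H. P (sym_diff T E)} {T \<in> Pow H. P T}"
    using assms by (intro bij_betw_byWitness[where f' = "\<lambda>T. sym_diff T E"]) auto
qed

text \<open>A further handle contributes \<open>1\<close> to the sum for one of its four bit patterns and \<open>0\<close>
  for the other three. Hence the total is multiplied by four at each step, and the excess of
  even over odd vectors by two.\<close>

lemma arf_counts:
  "card {S \<in> Pow (handle_gens n). arf n S} + card {S \<in> Pow (handle_gens n). \<not> arf n S} = 4 ^ n"
  "card {S \<in> Pow (handle_gens n). \<not> arf n S} = card {S \<in> Pow (handle_gens n). arf n S} + 2 ^ n"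
proof (induction n)
  case 0
  show "card {S \<in> Pow (handle_gens 0). arf 0 S} + card {S \<in> Pow (handle_gens 0). \<not> arf 0 S} = 4 ^ 0"
    "card {S \<in> Pow (handle_gens 0). \<not> arf 0 S} = card {S \<in> Pow (handle_gens 0). arf 0 S} + 2 ^ 0"
    by (simp_all add: arf_def handle_gens_def)
next
  case (Suc n)
  have new: "GenA (Suc n) \<notin> insert (GenB (Suc n)) (handle_gens n)"
    "GenB (Suc n) \<notin> handle_gens n"
    by (auto simp: handle_gens_def)
  let ?T = "{S \<in> Pow (handle_gens n). arf n S}" and ?F = "{S \<in> Pow (handle_gens n). \<not> arf n S}"
  let ?T' = "{S \<in> Pow (handle_gens (Suc n)). arf (Suc n) S}"
    and ?F' = "{S \<in> Pow (handle_gens (Suc n)). \<not> arf (Suc n) S}"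
  have T: "card ?T' = 3 * card ?T + card ?F" and F: "card ?F' = 3 * card ?F + card ?T"
    unfolding handle_gens_Suc card_subsets_insert[OF finite.insertI[OF finite_handle_gens] new(1)]
      card_subsets_insert[OF finite_handle_gens new(2)]
    by (simp_all add: arf_card_step cong: conj_cong)
  from Suc show "card ?T' + card ?F' = 4 ^ Suc n" unfolding T F by simp
  from Suc show "card ?F' = card ?T' + 2 ^ Suc n" unfolding T F by simp
qed

text \<open>The parameter \<open>c\<close> stands for the Arf invariant of the group. Exchanging its two
  values exchanges the two factors, which is the reason for the independence of the isomorphism
  type.\<close>

lemma arf_counts_product:
  assumes "n \<ge> 1"
  shows "2 * (card {S \<in> Pow (handle_gens n). arf n S = c} * card {S \<in> Pow (handle_gens n). arf n S \<noteq> c})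
    = 2 ^ (2 * n - 1) * (2 ^ (2 * n) - 1)"
proof -
  define t where "t = card {S \<in> Pow (handle_gens n). arf n S}"
  define f where "f = card {S \<in> Pow (handle_gens n). \<not> arf n S}"
  have tf: "t + f = 4 ^ n" and f: "f = t + 2 ^ n" unfolding t_def f_def by (rule arf_counts)+
  define m :: nat where "m = 2 ^ n"
  have m: "m ^ 2 = 2 ^ (2 * n)" unfolding m_def by (simp only: power_mult[symmetric] mult.commute)
  have "(2::nat) ^ (2 * n) = 4 ^ n" by (simp only: power_mult) simp
  with m have "4 ^ n = m ^ 2" by (simp only:)
  with tf f have s: "2 * t + m = m ^ 2" and f': "f = t + m" by (simp_all only: m_def[symmetric])
  have "4 * (t * f) + m ^ 2 = (2 * t + m) ^ 2"
    unfolding f' by (simp add: power2_eq_square algebra_simps)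
  then have "4 * (t * f) = m ^ 2 * (m ^ 2 - 1)"
    unfolding s by (simp add: power2_eq_square diff_mult_distrib2)
  moreover have "(2::nat) ^ (2 * n) = 2 * 2 ^ (2 * n - 1)"
    using assms by (simp flip: power_Suc)
  ultimately have "2 * (t * f) = 2 ^ (2 * n - 1) * (2 ^ (2 * n) - 1)"
    unfolding m by (simp add: ac_simps)
  then show ?thesis by (cases c) (simp_all add: t_def f_def mult.commute)
qed

section \<open>Two-groups with centre of order two and central squares\<close>

locale extraspecial_two_group = group G for G :: "'a monoid" (structure) +
  fixes z :: 'a
  assumes finite_carrier: "finite (carrier G)"
    and center_eq: "center G = {\<one>, z}"
    and z_neq_one: "z \<noteq> \<one>"
    and square_in_center: "x \<in> carrier G \<Longrightarrow> x \<otimes> x \<in> {\<one>, z}"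
    and commutator_in_center:
      "x \<in> carrier G \<Longrightarrow> y \<in> carrier G \<Longrightarrow> x \<otimes> y = y \<otimes> x \<or> x \<otimes> y = z \<otimes> (y \<otimes> x)"
begin

text \<open>The isomorphism of the field with two elements, written as \<open>bool\<close> with \<open>\<noteq>\<close> as addition,
  onto the centre.\<close>

definition central_sign :: "bool \<Rightarrow> 'a" where
  "central_sign b = (if b then z else \<one>)"

text \<open>The alternating form on \<open>G / Z(G)\<close>, and below it the quadratic form that polarizes to
  it. Both are kept as predicates on \<open>G\<close>, which avoids the quotient.\<close>

definition anticommute :: "'a \<Rightarrow> 'a \<Rightarrow> bool" where
  "anticommute x y \<longleftrightarrow> x \<otimes> y \<noteq> y \<otimes> x"

definition nontrivial_square :: "'a \<Rightarrow> bool" where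
  "nontrivial_square x \<longleftrightarrow> x \<otimes> x \<noteq> \<one>"

lemma z_carrier [simp]: "z \<in> carrier G"
  using center_eq by (auto simp: center_def)

lemma z_comm: "x \<in> carrier G \<Longrightarrow> z \<otimes> x = x \<otimes> z"
  using center_eq by (auto simp: center_def)

lemma central_sign_carrier [simp]: "central_sign b \<in> carrier G"
  by (simp add: central_sign_def)

lemma central_sign_comm: "x \<in> carrier G \<Longrightarrow> x \<otimes> central_sign b = central_sign b \<otimes> x"
  by (simp add: central_sign_def z_comm)

lemma central_sign_left_comm:
  "x \<in> carrier G \<Longrightarrow> y \<in> carrier G
    \<Longrightarrow> x \<otimes> (central_sign b \<otimes> y) = central_sign b \<otimes> (x \<otimes> y)"
  by (metis central_sign_comm central_sign_carrier m_assoc)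

lemma central_sign_eq_iff [simp]: "central_sign b = central_sign c \<longleftrightarrow> b = c"
  using z_neq_one by (auto simp: central_sign_def)

lemma z_square: "z \<otimes> z = \<one>"
  using square_in_center[of z] z_neq_one r_cancel_one[of z z] by auto

lemma central_sign_mult: "central_sign b \<otimes> central_sign c = central_sign (b \<noteq> c)"
  by (auto simp: central_sign_def z_square)

lemma central_sign_mult_left:
  "x \<in> carrier G \<Longrightarrow> central_sign b \<otimes> (central_sign c \<otimes> x) = central_sign (b \<noteq> c) \<otimes> x"
  by (simp add: central_sign_mult flip: m_assoc)

lemma central_sign_cancel:
  "x \<in> carrier G \<Longrightarrow> central_sign b \<otimes> x = central_sign c \<otimes> x \<longleftrightarrow> b = c"
  by (simp add: r_cancel)

lemma inv_central_sign [simp]: "inv (central_sign b) = central_sign b"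
  by (rule inv_equality) (auto simp: central_sign_mult, simp add: central_sign_def)

lemma swap:
  "x \<in> carrier G \<Longrightarrow> y \<in> carrier G \<Longrightarrow> x \<otimes> y = central_sign (anticommute x y) \<otimes> (y \<otimes> x)"
  using commutator_in_center[of x y] by (auto simp: anticommute_def central_sign_def)

lemma square: "x \<in> carrier G \<Longrightarrow> x \<otimes> x = central_sign (nontrivial_square x)"
  using square_in_center[of x] by (auto simp: nontrivial_square_def central_sign_def)

lemma anticommute_iff:
  assumes "x \<in> carrier G" "y \<in> carrier G" "x \<otimes> y = central_sign b \<otimes> (y \<otimes> x)"
  shows "anticommute x y \<longleftrightarrow> b"
  using assms swap[of x y] central_sign_cancel[of "y \<otimes> x" "anticommute x y" b] by simp

lemma anticommute_sym: "anticommute x y \<longleftrightarrow> anticommute y x"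
  by (auto simp: anticommute_def)

lemma anticommute_refl [simp]: "\<not> anticommute x x"
  by (simp add: anticommute_def)

lemma anticommute_mult_left:
  assumes "x \<in> carrier G" "y \<in> carrier G" "w \<in> carrier G"
  shows "anticommute (x \<otimes> y) w \<longleftrightarrow> (anticommute x w \<noteq> anticommute y w)"
proof (rule anticommute_iff)
  have "(x \<otimes> y) \<otimes> w = x \<otimes> (central_sign (anticommute y w) \<otimes> (w \<otimes> y))"
    using assms swap[of y w] by (simp add: m_assoc)
  also have "\<dots> = central_sign (anticommute y w) \<otimes> (x \<otimes> w \<otimes> y)"
    using assms by (simp add: central_sign_left_comm m_assoc)
  also have "\<dots> = central_sign (anticommute y w) \<otimes> (central_sign (anticommute x w) \<otimes> (w \<otimes> x \<otimes> y))"
    using assms swap[of x w] by (simp add: m_assoc)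
  also have "\<dots> = central_sign (anticommute y w \<noteq> anticommute x w) \<otimes> (w \<otimes> (x \<otimes> y))"
    using assms by (simp add: central_sign_mult_left m_assoc)
  finally show "(x \<otimes> y) \<otimes> w
      = central_sign (anticommute x w \<noteq> anticommute y w) \<otimes> (w \<otimes> (x \<otimes> y))"
    by (simp add: eq_commute[of "anticommute x w"])
qed (use assms in auto)

lemma anticommute_mult_right:
  assumes "x \<in> carrier G" "y \<in> carrier G" "w \<in> carrier G"
  shows "anticommute w (x \<otimes> y) \<longleftrightarrow> (anticommute w x \<noteq> anticommute w y)"
  using anticommute_mult_left[OF assms] by (simp add: anticommute_sym)

lemma anticommute_central_sign [simp]:
  "x \<in> carrier G \<Longrightarrow> \<not> anticommute x (central_sign b)"
  "x \<in> carrier G \<Longrightarrow> \<not> anticommute (central_sign b) x"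
  by (simp_all add: anticommute_def central_sign_comm)

lemma anticommute_one [simp]:
  "x \<in> carrier G \<Longrightarrow> \<not> anticommute x \<one>"
  "x \<in> carrier G \<Longrightarrow> \<not> anticommute \<one> x"
  by (simp_all add: anticommute_def)

lemma anticommute_inv [simp]:
  assumes "x \<in> carrier G" "y \<in> carrier G"
  shows "anticommute x (inv y) \<longleftrightarrow> anticommute x y" "anticommute (inv y) x \<longleftrightarrow> anticommute y x"
  using anticommute_mult_right[of y "inv y" x] assms by (simp_all add: anticommute_sym)

lemma nontrivial_square_mult:
  assumes "x \<in> carrier G" "y \<in> carrier G"
  shows "nontrivial_square (x \<otimes> y)
    \<longleftrightarrow> ((nontrivial_square x \<noteq> nontrivial_square y) \<noteq> anticommute x y)"
proof -
  have "(x \<otimes> y) \<otimes> (x \<otimes> y) = x \<otimes> (y \<otimes> x) \<otimes> y" using assms by (simp add: m_assoc)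
  also have "\<dots> = x \<otimes> (central_sign (anticommute y x) \<otimes> (x \<otimes> y)) \<otimes> y"
    using assms swap[of y x] by simp
  also have "\<dots> = central_sign (anticommute y x) \<otimes> (x \<otimes> x) \<otimes> (y \<otimes> y)"
    using assms by (simp add: central_sign_left_comm m_assoc)
  finally have "central_sign (nontrivial_square (x \<otimes> y))
      = central_sign ((anticommute y x \<noteq> nontrivial_square x) \<noteq> nontrivial_square y)"
    using assms by (simp add: square central_sign_mult)
  then show ?thesis by (auto simp: anticommute_sym[of y x])
qed

lemma nontrivial_square_central_sign [simp]: "\<not> nontrivial_square (central_sign b)"
  using central_sign_mult[of b b] by (simp add: nontrivial_square_def central_sign_def)

lemma central_iff_sign:
  assumes "x \<in> carrier G"
  shows "(\<forall>y\<in>carrier G. \<not> anticommute x y) \<longleftrightarrow> (\<exists>b. x = central_sign b)"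
proof -
  have "(\<forall>y\<in>carrier G. \<not> anticommute x y) \<longleftrightarrow> x \<in> center G"
    using assms by (simp add: center_def anticommute_def)
  also have "\<dots> \<longleftrightarrow> (\<exists>b. x = central_sign b)"
    unfolding center_eq by (auto simp: central_sign_def split: if_splits)
  finally show ?thesis .
qed

lemma commutator_value:
  assumes "x \<in> carrier G" "y \<in> carrier G"
  shows "x \<otimes> (y \<otimes> (inv x \<otimes> inv y)) = central_sign (anticommute x y)"
proof -
  have "x \<otimes> (y \<otimes> (inv x \<otimes> inv y)) = (x \<otimes> y) \<otimes> (inv x \<otimes> inv y)" using assms by (simp add: m_assoc)
  also have "\<dots> = central_sign (anticommute x y) \<otimes> ((y \<otimes> x) \<otimes> inv (y \<otimes> x))"
    using assms swap[of x y] by (simp add: inv_mult_group m_assoc)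
  finally show ?thesis using assms by simp
qed

end

section \<open>Symplectic systems\<close>

context extraspecial_two_group
begin

text \<open>Lifts of the first \<open>n\<close> handles of a symplectic basis.\<close>

definition symplectic :: "nat \<Rightarrow> (braid_gen \<Rightarrow> 'a) \<Rightarrow> bool" where
  "symplectic n x \<longleftrightarrow> x \<in> handle_gens n \<rightarrow> carrier G
     \<and> (\<forall>i\<in>handle_gens n. \<forall>j\<in>handle_gens n. anticommute (x i) (x j) \<longleftrightarrow> j = dual i)"

text \<open>The coordinates of \<open>y\<close> with respect to the dual basis of \<open>x\<close>.\<close>

definition profile :: "nat \<Rightarrow> (braid_gen \<Rightarrow> 'a) \<Rightarrow> 'a \<Rightarrow> braid_gen set" where
  "profile n x y = {j \<in> handle_gens n. anticommute y (x j)}"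

definition square_set :: "nat \<Rightarrow> (braid_gen \<Rightarrow> 'a) \<Rightarrow> braid_gen set" where
  "square_set n x = {j \<in> handle_gens n. nontrivial_square (x j)}"

lemma symplectic_funcset: "symplectic n x \<Longrightarrow> x \<in> handle_gens n \<rightarrow> carrier G"
  by (simp add: symplectic_def)

lemma symplectic_carrier: "symplectic n x \<Longrightarrow> j \<in> handle_gens n \<Longrightarrow> x j \<in> carrier G"
  by (auto simp: symplectic_def)

lemma profile_subset: "profile n x y \<subseteq> handle_gens n"
  by (auto simp: profile_def)

lemma profile_mult:
  assumes "x \<in> handle_gens n \<rightarrow> carrier G" "y \<in> carrier G" "w \<in> carrier G"
  shows "profile n x (y \<otimes> w) = sym_diff (profile n x y) (profile n x w)"
proof -
  have "anticommute (y \<otimes> w) (x j) \<longleftrightarrow> (anticommute y (x j) \<noteq> anticommute w (x j))"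
    if "j \<in> handle_gens n" for j
    using assms that by (intro anticommute_mult_left) auto
  then show ?thesis by (auto simp: profile_def)
qed

lemma profile_central_sign:
  "x \<in> handle_gens n \<rightarrow> carrier G \<Longrightarrow> profile n x (central_sign b) = {}"
  by (auto simp: profile_def Pi_iff)

lemma profile_one:
  "x \<in> handle_gens n \<rightarrow> carrier G \<Longrightarrow> profile n x \<one> = {}"
  by (auto simp: profile_def Pi_iff)

lemma profile_generator:
  "symplectic n x \<Longrightarrow> j \<in> handle_gens n \<Longrightarrow> profile n x (x j) = {dual j}"
  by (auto simp: profile_def symplectic_def)

text \<open>The members of the system have the singletons as profiles. The preimage is
  produced as a word because words inherit commutation properties from the system
  (\<open>commutes_with_word\<close>).\<close>

lemma profile_onto:
  assumes x: "symplectic n x" and T: "T \<subseteq> handle_gens n"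
  shows "\<exists>w\<in>gwords (handle_gens n). profile n x (word_value G x w) = T"
proof -
  have "finite T" using T by (rule finite_subset) simp
  then show ?thesis using T
  proof (induction T)
    case empty
    show ?case using profile_one[OF symplectic_funcset[OF x]] by (intro bexI[of _ "[]"]) auto
  next
    case (insert j T)
    then obtain w where w: "w \<in> gwords (handle_gens n)" "profile n x (word_value G x w) = T"
      by auto
    have j: "dual j \<in> handle_gens n" using insert.prems by simp
    have "profile n x (word_value G x ((dual j, True) # w)) = sym_diff {j} T"
      using profile_mult[OF symplectic_funcset[OF x], of "x (dual j)" "word_value G x w"]
        profile_generator[OF x j] w symplectic_carrier[OF x j]
        word_value_closed[OF w(1) symplectic_funcset[OF x]] by simp
    also have "\<dots> = insert j T" using insert.hyps(2) by auto
    finally show ?case using w(1) j by (intro bexI[of _ "(dual j, True) # w"]) auto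
  qed
qed

lemma commutes_with_word:
  assumes "w \<in> gwords S" "x \<in> S \<rightarrow> carrier G" "y \<in> carrier G" "\<And>s. s \<in> S \<Longrightarrow> \<not> anticommute y (x s)"
  shows "\<not> anticommute y (word_value G x w)"
  using assms(1)
proof (induction w)
  case (Cons l w)
  obtain s e where l: "l = (s, e)" by force
  have s: "s \<in> S" "x s \<in> carrier G" and w: "word_value G x w \<in> carrier G"
    using Cons.prems l assms(2) by (auto intro: word_value_closed)
  then show ?case
    using Cons.IH Cons.prems assms(3,4) l by (auto simp: anticommute_mult_right)
qed (use assms in auto)

text \<open>The profile is a homomorphism onto the bit vectors, so its fibres are the cosets of
  its kernel.\<close>

lemma card_profile:
  assumes x: "symplectic n x"
  shows "card {y \<in> carrier G. P (profile n x y)}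
    = card {y \<in> carrier G. profile n x y = {}} * card {T \<in> Pow (handle_gens n). P T}"
proof -
  note xf = symplectic_funcset[OF x]
  let ?K = "{y \<in> carrier G. profile n x y = {}}" and ?T = "{T \<in> Pow (handle_gens n). P T}"
  have "\<forall>T\<in>Pow (handle_gens n). \<exists>h\<in>carrier G. profile n x h = T"
    using profile_onto[OF x] word_value_closed[OF _ xf] by (metis PowD)
  then obtain h where h: "\<And>T. T \<in> Pow (handle_gens n) \<Longrightarrow> h T \<in> carrier G \<and> profile n x (h T) = T"
    by metis
  have val: "profile n x (k \<otimes> h T) = T" if "k \<in> ?K" "T \<in> Pow (handle_gens n)" for k T
    using that h[OF that(2)] profile_mult[OF xf, of k "h T"] by simp
  have "bij_betw (\<lambda>(k, T). k \<otimes> h T) (?K \<times> ?T) {y \<in> carrier G. P (profile n x y)}"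
    unfolding bij_betw_def
  proof
    show "inj_on (\<lambda>(k, T). k \<otimes> h T) (?K \<times> ?T)"
    proof (rule inj_onI, clarify)
      fix k T k' T'
      assume a: "k \<in> carrier G" "profile n x k = {}" "T \<subseteq> handle_gens n"
        "k' \<in> carrier G" "profile n x k' = {}" "T' \<subseteq> handle_gens n" "k \<otimes> h T = k' \<otimes> h T'"
      then have "T = T'" using val[of k T] val[of k' T'] by simp
      then show "k = k' \<and> T = T'" using a h[of T] by simp
    qed
    show "(\<lambda>(k, T). k \<otimes> h T) ` (?K \<times> ?T) = {y \<in> carrier G. P (profile n x y)}"
    proof
      show "(\<lambda>(k, T). k \<otimes> h T) ` (?K \<times> ?T) \<subseteq> {y \<in> carrier G. P (profile n x y)}"
      proof clarify
        fix k T assume "k \<in> carrier G" "profile n x k = {}" "T \<subseteq> handle_gens n" "P T"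
        then show "k \<otimes> h T \<in> carrier G \<and> P (profile n x (k \<otimes> h T))"
          using val[of k T] h[of T] by simp
      qed
      show "{y \<in> carrier G. P (profile n x y)} \<subseteq> (\<lambda>(k, T). k \<otimes> h T) ` (?K \<times> ?T)"
      proof
        fix y assume y: "y \<in> {y \<in> carrier G. P (profile n x y)}"
        define T where "T = profile n x y"
        have T: "T \<in> Pow (handle_gens n)" using profile_subset by (auto simp: T_def)
        define k where "k = y \<otimes> inv (h T)"
        have k: "k \<in> carrier G" "k \<otimes> h T = y" using y h[OF T] by (auto simp: k_def m_assoc)
        then have "sym_diff (profile n x k) T = T"
          using profile_mult[OF xf, of k "h T"] h[OF T] by (simp add: T_def)
        then have "profile n x k = {}" by blast
        then show "y \<in> (\<lambda>(k, T). k \<otimes> h T) ` (?K \<times> ?T)"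
          using k T y by (intro image_eqI[of _ _ "(k, T)"]) (auto simp: T_def)
      qed
    qed
  qed
  then have "card (?K \<times> ?T) = card {y \<in> carrier G. P (profile n x y)}"
    by (rule bij_betw_same_card)
  then show ?thesis by (simp add: card_cartesian_product)
qed

lemma card_commuting:
  assumes x: "symplectic n x"
  shows "order G = card {y \<in> carrier G. profile n x y = {}} * 4 ^ n"
proof -
  have "{T \<in> Pow (handle_gens n). True} = Pow (handle_gens n)" by auto
  moreover have "{y \<in> carrier G. True} = carrier G" by simp
  moreover have "(2::nat) ^ (2 * n) = 4 ^ n" by (simp only: power_mult) simp
  ultimately show ?thesis
    using card_profile[OF x, of "\<lambda>_. True"] by (simp add: order_def card_Pow card_handle_gens)
qed

text \<open>One step of the symplectic Gram-Schmidt process. By counting, the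
  centralizer of the system is larger than the centre, so it contains some \<open>y\<close> that fails to
  commute with some \<open>w\<close>; multiplying \<open>w\<close> by a word in the system that has the same profile
  moves it into the centralizer, and leaves its commutator with \<open>y\<close> unchanged.\<close>

lemma symplectic_extend:
  assumes x: "symplectic k x" and big: "2 * 4 ^ k < order G"
  shows "\<exists>x'. symplectic (Suc k) x'"
proof -
  note xf = symplectic_funcset[OF x]
  let ?K = "{y \<in> carrier G. profile k x y = {}}"
  have "2 < card ?K" using big card_commuting[OF x] by simp
  moreover have "card {\<one>, z} \<le> 2" by (simp add: card_insert_if)
  ultimately have "\<not> ?K \<subseteq> {\<one>, z}" using card_mono[of "{\<one>, z}" ?K] by auto
  then obtain y where y: "y \<in> carrier G" "profile k x y = {}" "y \<noteq> \<one>" "y \<noteq> z" by auto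
  then have "\<not> (\<exists>b. y = central_sign b)" by (auto simp: central_sign_def split: if_splits)
  then obtain w where w: "w \<in> carrier G" "anticommute y w"
    using central_iff_sign[OF y(1)] by blast
  obtain u where u: "u \<in> gwords (handle_gens k)" "profile k x (word_value G x u) = profile k x w"
    using profile_onto[OF x profile_subset] by blast
  define w' where "w' = w \<otimes> word_value G x u"
  have uc: "word_value G x u \<in> carrier G" using u(1) xf by (rule word_value_closed)
  have w'c: "w' \<in> carrier G" using w(1) uc by (simp add: w'_def)
  have w': "profile k x w' = {}" using profile_mult[OF xf w(1) uc] u(2) by (simp add: w'_def)
  have "\<not> anticommute y (word_value G x u)"
    using y by (intro commutes_with_word[OF u(1) xf]) (auto simp: profile_def)
  then have yw': "anticommute y w'"
    using w y uc by (simp add: w'_def anticommute_mult_right)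
  have yx: "\<not> anticommute y (x j)" "\<not> anticommute w' (x j)" if "j \<in> handle_gens k" for j
    using that y(2) w' by (auto simp: profile_def)
  define x' where "x' = x(GenA (Suc k) := y, GenB (Suc k) := w')"
  have new: "GenA (Suc k) \<notin> handle_gens k" "GenB (Suc k) \<notin> handle_gens k"
    by (auto simp: handle_gens_def)
  have x'1: "x' (GenA (Suc k)) = y" "x' (GenB (Suc k)) = w'"
    and x'2: "\<And>j. j \<in> handle_gens k \<Longrightarrow> x' j = x j"
    using new by (auto simp: x'_def)
  have dn: "dual j \<noteq> GenA (Suc k)" "dual j \<noteq> GenB (Suc k)"
      "j \<noteq> GenA (Suc k)" "j \<noteq> GenB (Suc k)" if "j \<in> handle_gens k" for j
    using new that dual_in_handle_gens[of j k] by metis+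
  have "symplectic (Suc k) x'"
    unfolding symplectic_def
  proof (intro conjI ballI)
    show "x' \<in> handle_gens (Suc k) \<rightarrow> carrier G"
      using xf y(1) w'c by (auto simp: handle_gens_Suc x'1 x'2)
  next
    fix i j assume "i \<in> handle_gens (Suc k)" "j \<in> handle_gens (Suc k)"
    then consider "i \<in> handle_gens k" "j \<in> handle_gens k"
      | "i \<in> handle_gens k" "j = GenA (Suc k) \<or> j = GenB (Suc k)"
      | "i = GenA (Suc k) \<or> i = GenB (Suc k)" "j \<in> handle_gens k"
      | "i = GenA (Suc k) \<or> i = GenB (Suc k)" "j = GenA (Suc k) \<or> j = GenB (Suc k)"
      by (auto simp: handle_gens_Suc)
    then show "anticommute (x' i) (x' j) \<longleftrightarrow> j = dual i"
    proof cases
      case 1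
      then show ?thesis using x by (simp add: x'2 symplectic_def)
    next
      case 2
      then have "\<not> anticommute (x' j) (x' i)" using yx[OF 2(1)] x'1 x'2[OF 2(1)] by auto
      moreover have "j \<noteq> dual i" using dn[OF 2(1)] 2(2) by auto
      ultimately show ?thesis by (simp only: anticommute_sym[of "x' i" "x' j"] simp_thms)
    next
      case 3
      then have "\<not> anticommute (x' i) (x' j)" using yx[OF 3(2)] x'1 x'2[OF 3(2)] by auto
      moreover have "j \<noteq> dual i" using dn[OF 3(2)] 3(1) by auto
      ultimately show ?thesis by simp
    next
      case 4
      moreover have "anticommute w' y" using yw' by (simp only: anticommute_sym[of w' y])
      ultimately show ?thesis using yw' by (elim disjE) (simp_all add: x'1)
    qed
  qed
  then show ?thesis by blast
qed

definition letter_count :: "braid_gen \<Rightarrow> braid_gen gword \<Rightarrow> nat" where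
  "letter_count j w = length (filter (\<lambda>l. fst l = j) w)"

lemma anticommute_word_value:
  assumes x: "symplectic n x" and i: "i \<in> handle_gens n" and "w \<in> gwords (handle_gens n)"
  shows "anticommute (x i) (word_value G x w) \<longleftrightarrow> odd (letter_count (dual i) w)"
  using assms(3)
proof (induction w)
  case (Cons l w)
  obtain s e where l: "l = (s, e)" by force
  have s: "s \<in> handle_gens n" and w: "w \<in> gwords (handle_gens n)" using Cons.prems l by auto
  have "anticommute (x i) (x s) \<longleftrightarrow> s = dual i" using x i s by (simp add: symplectic_def)
  then show ?case
    using Cons.IH[OF w] l symplectic_carrier[OF x i] symplectic_carrier[OF x s]
      word_value_closed[OF w symplectic_funcset[OF x]]
    by (auto simp: anticommute_mult_right letter_count_def)
qed (use symplectic_carrier[OF x i] in \<open>simp add: letter_count_def\<close>)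

text \<open>Moving the first letter of a word next to a later occurrence of the same letter costs
  commutators, and the two occurrences then merge into a square. All signs that arise can be
  read off from the word and from the square set, so they agree for any two systems with the same
  square set.\<close>

lemma word_value_cancel_letter:
  assumes x: "symplectic n x" and j: "j \<in> handle_gens n"
    and u: "u \<in> gwords (handle_gens n)" and v: "v \<in> gwords (handle_gens n)"
  shows "word_value G x ((j, e) # u @ (j, e') # v)
    = central_sign (odd (letter_count (dual j) u) \<noteq> (e = e' \<and> j \<in> square_set n x))
        \<otimes> word_value G x (u @ v)"
proof -
  note xf = symplectic_funcset[OF x]
  define p where "p e = (if e then x j else inv (x j))" for e
  have xj: "x j \<in> carrier G" using symplectic_carrier[OF x j] .
  have pc: "p e \<in> carrier G" for e using xj by (simp add: p_def)
  have q: "nontrivial_square (x j) \<longleftrightarrow> j \<in> square_set n x" using j by (simp add: square_set_def)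
  have "inv (x j) \<otimes> inv (x j) = central_sign (nontrivial_square (x j))"
    using xj square[OF xj] by (simp flip: inv_mult_group)
  then have pp: "p e \<otimes> p e' = central_sign (e = e' \<and> j \<in> square_set n x)"
    using xj square[OF xj] q by (cases e; cases e') (simp_all add: p_def, simp_all add: central_sign_def)
  let ?U = "word_value G x u" and ?V = "word_value G x v"
  have U: "?U \<in> carrier G" "?V \<in> carrier G" using u v xf word_value_closed by blast+
  have "anticommute (p e) ?U \<longleftrightarrow> anticommute (x j) ?U"
    using xj U by (simp add: p_def)
  also have "\<dots> \<longleftrightarrow> odd (letter_count (dual j) u)" by (rule anticommute_word_value[OF x j u])
  finally have a: "p e \<otimes> ?U = central_sign (odd (letter_count (dual j) u)) \<otimes> (?U \<otimes> p e)"
    using swap[OF pc U(1)] by simp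
  have "word_value G x ((j, e) # u @ (j, e') # v) = p e \<otimes> (?U \<otimes> (p e' \<otimes> ?V))"
    using word_value_append[OF u _ xf, of "(j, e') # v"] j v by (simp add: p_def)
  also have "\<dots> = p e \<otimes> ?U \<otimes> (p e' \<otimes> ?V)" using pc U by (simp add: m_assoc)
  also have "\<dots> = central_sign (odd (letter_count (dual j) u)) \<otimes> (?U \<otimes> ((p e \<otimes> p e') \<otimes> ?V))"
    unfolding a using pc U by (simp add: m_assoc)
  also have "\<dots> = central_sign (odd (letter_count (dual j) u))
      \<otimes> (central_sign (e = e' \<and> j \<in> square_set n x) \<otimes> (?U \<otimes> ?V))"
    by (simp only: pp central_sign_left_comm[OF U])
  finally show ?thesis using U by (simp add: central_sign_mult_left word_value_append[OF u v xf])
qed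

text \<open>A word whose value is central contains every letter an even number of times, so it
  can be shortened by cancelling its first letter until it is empty, with the same signs in both
  systems.\<close>

lemma central_word_transfer:
  assumes x: "symplectic n x" and y: "symplectic n y" and sq: "square_set n x = square_set n y"
    and "w \<in> gwords (handle_gens n)" "word_value G x w = central_sign b"
  shows "word_value G y w = central_sign b"
  using assms(4,5)
proof (induction "length w" arbitrary: w b rule: less_induct)
  case less
  show ?case
  proof (cases w)
    case Nil
    then show ?thesis using less.prems by simp
  next
    case (Cons l r)
    obtain j e where l: "l = (j, e)" by force
    have j: "j \<in> handle_gens n" and r: "r \<in> gwords (handle_gens n)"
      using less.prems Cons l by auto
    have "\<not> odd (letter_count j w)"
      using anticommute_word_value[OF x _ less.prems(1), of "dual j"] less.prems(2) j
        symplectic_carrier[OF x, of "dual j"] by simp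
    then have "filter (\<lambda>l. fst l = j) r \<noteq> []" by (auto simp: Cons l letter_count_def)
    then obtain e' where "(j, e') \<in> set r" by (auto simp: filter_empty_conv)
    then obtain u v where uv: "r = u @ (j, e') # v" by (auto simp: in_set_conv_decomp)
    then have u: "u \<in> gwords (handle_gens n)" and v: "v \<in> gwords (handle_gens n)"
      using r by auto
    define c where "c = (odd (letter_count (dual j) u) \<noteq> (e = e' \<and> j \<in> square_set n x))"
    note uvc = word_value_closed[OF _ symplectic_funcset[OF x], of "u @ v"]
    have wx: "word_value G x w = central_sign c \<otimes> word_value G x (u @ v)"
      using word_value_cancel_letter[OF x j u v, of e e'] by (simp add: Cons l uv c_def)
    have wy: "word_value G y w = central_sign c \<otimes> word_value G y (u @ v)"
      using word_value_cancel_letter[OF y j u v, of e e'] by (simp add: Cons l uv c_def sq)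
    have "central_sign c \<otimes> (central_sign c \<otimes> word_value G x (u @ v)) = central_sign (c \<noteq> b)"
      using less.prems(2) wx by (simp add: central_sign_mult)
    then have "word_value G x (u @ v) = central_sign (c \<noteq> b)"
      using uvc u v by (simp add: central_sign_mult_left) (simp add: central_sign_def)
    then have "word_value G y (u @ v) = central_sign (c \<noteq> b)"
      using u v by (intro less.hyps) (auto simp: Cons uv)
    then show ?thesis using wy by (cases b; cases c) (simp_all add: central_sign_mult)
  qed
qed

end

section \<open>Full symplectic systems and automorphisms\<close>

locale extraspecial_of_rank = extraspecial_two_group +
  fixes n :: nat
  assumes order_eq: "order G = 2 ^ (2 * n + 1)" and rank_pos: "n \<ge> 1"
begin

lemma order_eq_four_power: "order G = 2 * 4 ^ n"
  unfolding order_eq by (simp add: power_add power_mult)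

lemma symplectic_exists: "\<exists>x. symplectic n x"
proof -
  have "k \<le> n \<Longrightarrow> \<exists>x. symplectic k x" for k
  proof (induction k)
    case 0
    then show ?case by (auto simp: symplectic_def handle_gens_def)
  next
    case (Suc k)
    then obtain x where "symplectic k x" by auto
    moreover have "2 * 4 ^ k < order G" using Suc.prems by (simp add: order_eq_four_power)
    ultimately show ?case by (rule symplectic_extend)
  qed
  then show ?thesis by blast
qed

text \<open>A full system is a basis, so only the centre is orthogonal to it; here this is
  a count of elements.\<close>

lemma commuting_with_system:
  assumes x: "symplectic n x"
  shows "{y \<in> carrier G. profile n x y = {}} = {\<one>, z}"
proof (rule card_seteq[symmetric])
  show "finite {y \<in> carrier G. profile n x y = {}}" using finite_carrier by simp
  have "profile n x \<one> = {}" "profile n x z = {}"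
    using profile_central_sign[OF symplectic_funcset[OF x], of True]
      profile_one[OF symplectic_funcset[OF x]] by (simp_all add: central_sign_def)
  then show "{\<one>, z} \<subseteq> {y \<in> carrier G. profile n x y = {}}" by simp
  show "card {y \<in> carrier G. profile n x y = {}} \<le> card {\<one>, z}"
    using card_commuting[OF x] z_neq_one by (simp add: order_eq_four_power)
qed

lemma card_profile_full:
  assumes x: "symplectic n x"
  shows "card {y \<in> carrier G. P (profile n x y)} = 2 * card {T \<in> Pow (handle_gens n). P T}"
  using card_profile[OF x, of P] z_neq_one by (simp add: commuting_with_system[OF x])

text \<open>A word with the same profile as \<open>y\<close> differs from \<open>y\<close> by a central factor, and
  \<open>z\<close> itself is the commutator of the two generators of the first handle.\<close>

lemma symplectic_generates:
  assumes x: "symplectic n x" and y: "y \<in> carrier G"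
  shows "\<exists>w\<in>gwords (handle_gens n). word_value G x w = y"
proof -
  note xf = symplectic_funcset[OF x]
  obtain w where w: "w \<in> gwords (handle_gens n)" "profile n x (word_value G x w) = profile n x y"
    using profile_onto[OF x profile_subset] by blast
  have wc: "word_value G x w \<in> carrier G" using w(1) xf by (rule word_value_closed)
  define c where "c = y \<otimes> inv (word_value G x w)"
  have c: "c \<in> carrier G" "c \<otimes> word_value G x w = y" using y wc by (auto simp: c_def m_assoc)
  then have "sym_diff (profile n x c) (profile n x y) = profile n x y"
    using profile_mult[OF xf c(1) wc] w(2) by simp
  then have "profile n x c = {}" by blast
  then have "c \<in> {\<one>, z}" using commuting_with_system[OF x] c(1) by blast
  then obtain b where b: "c = central_sign b"
    by (metis central_sign_def insertE singletonD)
  let ?a = "[(GenA 1, True)]" and ?b = "[(GenB 1, True)]"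
  have gens: "GenA 1 \<in> handle_gens n" "GenB 1 \<in> handle_gens n"
    using rank_pos by (auto simp: handle_gens_def)
  have "anticommute (x (GenA 1)) (x (GenB 1))" using x gens by (simp add: symplectic_def)
  then have "word_value G x (gword_comm ?a ?b) = central_sign True"
    using commutator_value[of "x (GenA 1)" "x (GenB 1)"] gens xf
    by (simp add: gword_comm_def gword_inv_def Pi_iff)
  moreover have comm: "gword_comm ?a ?b \<in> gwords (handle_gens n)"
    using gens by (simp add: gword_comm_def gword_inv_def)
  ultimately have "word_value G x (gword_comm ?a ?b @ w) = central_sign True \<otimes> word_value G x w"
    using word_value_append[OF comm w(1) xf] by simp
  then show ?thesis
  proof (cases b)
    case True
    then show ?thesis
      using \<open>word_value G x (gword_comm ?a ?b @ w) = _\<close> c(2) b comm w(1)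
      by (intro bexI[of _ "gword_comm ?a ?b @ w"]) auto
  next
    case False
    then show ?thesis using c(2) b w(1) wc by (intro bexI[of _ w]) (auto simp: central_sign_def)
  qed
qed

text \<open>Adding the functional \<open>\<omega>(y, _)\<close> to the quadratic form \<open>q\<close> gives another quadratic form
  with the same polarization, and its Arf invariant is that of \<open>q\<close> plus \<open>q(y)\<close>. The proof runs over
  a word for \<open>y\<close>: multiplying by a further generator toggles one coordinate of the profile, and
  both sides change by the same amount.\<close>

lemma nontrivial_square_arf:
  assumes x: "symplectic n x" and y: "y \<in> carrier G"
  shows "nontrivial_square y
    \<longleftrightarrow> arf n (sym_diff (profile n x y) (square_set n x)) \<noteq> arf n (square_set n x)"
proof -
  note xf = symplectic_funcset[OF x]
  let ?E = "square_set n x"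
  have "nontrivial_square (word_value G x w)
      \<longleftrightarrow> arf n (sym_diff (profile n x (word_value G x w)) ?E) \<noteq> arf n ?E"
    if "w \<in> gwords (handle_gens n)" for w
    using that
  proof (induction w)
    case Nil
    show ?case using profile_one[OF xf] by (simp add: nontrivial_square_def)
  next
    case (Cons l w)
    obtain j e where l: "l = (j, e)" by force
    have j: "j \<in> handle_gens n" and w: "w \<in> gwords (handle_gens n)" using Cons.prems l by auto
    have xj: "x j \<in> carrier G" using symplectic_carrier[OF x j] .
    define u where "u = (if e then x j else inv (x j))"
    define v where "v = word_value G x w"
    define P where "P = profile n x v"
    have u: "u \<in> carrier G" using xj by (simp add: u_def)
    have v: "v \<in> carrier G" unfolding v_def using w xf by (rule word_value_closed)
    have pu: "profile n x u = {dual j}"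
    proof -
      have "anticommute u (x i) \<longleftrightarrow> anticommute (x j) (x i)" if "i \<in> handle_gens n" for i
        using xj symplectic_carrier[OF x that] by (simp add: u_def)
      then have "profile n x u = profile n x (x j)" by (auto simp: profile_def)
      then show ?thesis by (simp add: profile_generator[OF x j])
    qed
    have qu: "nontrivial_square u \<longleftrightarrow> j \<in> ?E"
    proof -
      have "nontrivial_square (inv (x j)) \<longleftrightarrow> nontrivial_square (x j)"
        using xj nontrivial_square_mult[of "x j" "inv (x j)"] nontrivial_square_central_sign[of False]
        by (simp add: central_sign_def)
      then show ?thesis using j by (simp add: u_def square_set_def)
    qed
    have "anticommute u v \<longleftrightarrow> anticommute v (x j)"
      using xj v by (simp add: u_def anticommute_sym[of v])
    then have auv: "anticommute u v \<longleftrightarrow> j \<in> P" using j by (simp add: P_def profile_def)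
    have pe: "sym_diff (profile n x (u \<otimes> v)) ?E = sym_diff (sym_diff P ?E) {dual j}"
      unfolding profile_mult[OF xf u v] pu P_def by blast
    have "dual j \<in> handle_gens n" using j by simp
    then have "arf n (sym_diff (profile n x (u \<otimes> v)) ?E)
        \<longleftrightarrow> arf n (sym_diff P ?E) \<noteq> (j \<in> sym_diff P ?E)"
      unfolding pe using arf_toggle[of "dual j" n "sym_diff P ?E"] by simp
    moreover have "nontrivial_square v \<longleftrightarrow> arf n (sym_diff P ?E) \<noteq> arf n ?E"
      using Cons.IH[OF w] by (simp add: P_def v_def)
    moreover have "nontrivial_square (u \<otimes> v)
        \<longleftrightarrow> ((nontrivial_square u \<noteq> nontrivial_square v) \<noteq> anticommute u v)"
      by (rule nontrivial_square_mult[OF u v])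
    ultimately have "nontrivial_square (u \<otimes> v)
        \<longleftrightarrow> arf n (sym_diff (profile n x (u \<otimes> v)) ?E) \<noteq> arf n ?E"
      using qu auv by (cases "j \<in> P"; cases "j \<in> ?E") simp_all
    then show ?case by (simp add: l u_def v_def)
  qed
  then show ?thesis using symplectic_generates[OF x y] by metis
qed

lemma card_nontrivial_squares:
  assumes x: "symplectic n x"
  shows "card {y \<in> carrier G. nontrivial_square y}
    = 2 * card {T \<in> Pow (handle_gens n). arf n T \<noteq> arf n (square_set n x)}"
proof -
  let ?E = "square_set n x"
  have "{y \<in> carrier G. nontrivial_square y}
      = {y \<in> carrier G. arf n (sym_diff (profile n x y) ?E) \<noteq> arf n ?E}"
    using nontrivial_square_arf[OF x] by blast
  also have "card \<dots> = 2 * card {T \<in> Pow (handle_gens n). arf n (sym_diff T ?E) \<noteq> arf n ?E}"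
    using card_profile_full[OF x, of "\<lambda>T. arf n (sym_diff T ?E) \<noteq> arf n ?E"] .
  also have "?E \<subseteq> handle_gens n" by (auto simp: square_set_def)
  note card_sym_diff_sets[OF this, of "\<lambda>T. arf n T \<noteq> arf n ?E"]
  finally show ?thesis .
qed

text \<open>The Arf invariant is determined by the number of elements with nontrivial square,
  because the two values of the invariant are taken with different frequencies.\<close>

lemma arf_square_set_unique:
  assumes "symplectic n x" "symplectic n y"
  shows "arf n (square_set n x) = arf n (square_set n y)"
proof (rule ccontr)
  assume ne: "arf n (square_set n x) \<noteq> arf n (square_set n y)"
  have "card {T \<in> Pow (handle_gens n). arf n T \<noteq> arf n (square_set n x)}
      = card {T \<in> Pow (handle_gens n). arf n T \<noteq> arf n (square_set n y)}"
    using card_nontrivial_squares[OF assms(1)] card_nontrivial_squares[OF assms(2)] by simp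
  then have "card {T \<in> Pow (handle_gens n). arf n T} = card {T \<in> Pow (handle_gens n). \<not> arf n T}"
    using ne by (cases "arf n (square_set n x)"; cases "arf n (square_set n y)") simp_all
  then show False using arf_counts(2)[of n] by simp
qed

text \<open>Let \<open>t\<close> represent the difference of the two vectors of squares under \<open>\<omega>\<close>. Since the Arf
  invariants agree, \<open>q(t) = 0\<close>, and for such \<open>t\<close> the transvection \<open>v \<mapsto> v + \<omega>(v, t) t\<close> satisfies
  \<open>q(v + \<omega>(v, t) t) = q(v) + \<omega>(v, t)\<close>.\<close>

lemma symplectic_transvection:
  assumes x: "symplectic n x" and E: "E \<subseteq> handle_gens n"
    and arf: "arf n E = arf n (square_set n x)"
  shows "\<exists>y. symplectic n y \<and> square_set n y = E"
proof -
  note xf = symplectic_funcset[OF x]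
  let ?E = "square_set n x"
  have "sym_diff E ?E \<subseteq> handle_gens n" using E by (auto simp: square_set_def)
  then obtain t where t: "t \<in> carrier G" "profile n x t = sym_diff E ?E"
    using profile_onto[OF x] word_value_closed[OF _ xf] by metis
  have "sym_diff (sym_diff E ?E) ?E = E" by blast
  then have qt: "\<not> nontrivial_square t"
    using nontrivial_square_arf[OF x t(1)] t(2) arf by simp
  define y where "y j = (if anticommute (x j) t then x j \<otimes> t else x j)" for j
  have yc: "y j \<in> carrier G" if "j \<in> handle_gens n" for j
    using symplectic_carrier[OF x that] t(1) by (simp add: y_def)
  have "anticommute (y i) (y j) \<longleftrightarrow> anticommute (x i) (x j)"
    if "i \<in> handle_gens n" "j \<in> handle_gens n" for i j
  proof -
    have "x i \<in> carrier G" "x j \<in> carrier G" using symplectic_carrier[OF x] that by auto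
    then show ?thesis
      using t(1) anticommute_sym[of t "x j"]
      by (auto simp: y_def anticommute_mult_left anticommute_mult_right)
  qed
  then have "symplectic n y" using x yc by (auto simp: symplectic_def)
  moreover have "nontrivial_square (y j) \<longleftrightarrow> j \<in> E" if j: "j \<in> handle_gens n" for j
  proof -
    have "anticommute (x j) t \<longleftrightarrow> j \<in> sym_diff E ?E"
      using t(2) j anticommute_sym[of t "x j"] by (auto simp: profile_def)
    moreover have "nontrivial_square (x j) \<longleftrightarrow> j \<in> ?E" using j by (simp add: square_set_def)
    ultimately show ?thesis
      using symplectic_carrier[OF x j] t(1) qt by (auto simp: y_def nontrivial_square_mult)
  qed
  then have "square_set n y = E" using E by (auto simp: square_set_def)
  ultimately show ?thesis by blast
qed

lemma word_value_transfer:
  assumes x: "symplectic n x" and y: "symplectic n y" and sq: "square_set n x = square_set n y"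
    and v: "v \<in> gwords (handle_gens n)" and w: "w \<in> gwords (handle_gens n)"
    and eq: "word_value G x v = word_value G x w"
  shows "word_value G y v = word_value G y w"
proof -
  note xf = symplectic_funcset[OF x] and yf = symplectic_funcset[OF y]
  note val = word_value_append[OF v gwords_inv[OF w]] word_value_gword_inv[OF w]
  have c: "word_value G x w \<in> carrier G" "word_value G y w \<in> carrier G" "word_value G y v \<in> carrier G"
    using v w xf yf by (blast intro: word_value_closed)+
  have "word_value G x (v @ gword_inv w) = central_sign False"
    using c by (simp add: val[OF xf] eq central_sign_def)
  moreover have "v @ gword_inv w \<in> gwords (handle_gens n)" using v w by (simp add: gwords_inv)
  ultimately have "word_value G y (v @ gword_inv w) = central_sign False"
    using central_word_transfer[OF x y sq] by blast
  then have "word_value G y v \<otimes> inv (word_value G y w) = \<one>"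
    by (simp add: val[OF yf] central_sign_def)
  then show ?thesis using c by (metis inv_equality inv_inv inv_closed)
qed

text \<open>The automorphism sends the value of a word in \<open>x\<close> to the value of the same word in
  \<open>y\<close>; that this is well defined is \<open>word_value_transfer\<close>.\<close>

lemma automorphism_extending:
  assumes x: "symplectic n x" and y: "symplectic n y" and sq: "square_set n x = square_set n y"
  shows "\<exists>\<alpha>\<in>auto G. \<forall>j\<in>handle_gens n. \<alpha> (x j) = y j"
proof -
  note xf = symplectic_funcset[OF x] and yf = symplectic_funcset[OF y]
  let ?W = "gwords (handle_gens n)"
  define \<alpha> where "\<alpha> = (\<lambda>u\<in>carrier G. word_value G y (SOME w. w \<in> ?W \<and> word_value G x w = u))"
  have \<alpha>: "\<alpha> (word_value G x w) = word_value G y w" if w: "w \<in> ?W" for w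
  proof -
    define v where "v = (SOME v. v \<in> ?W \<and> word_value G x v = word_value G x w)"
    have v: "v \<in> ?W \<and> word_value G x v = word_value G x w"
      unfolding v_def by (rule someI[of _ w]) (simp add: w)
    have "\<alpha> (word_value G x w) = word_value G y v"
      unfolding \<alpha>_def v_def using word_value_closed[OF w xf] by (simp only: restrict_apply')
    also have "\<dots> = word_value G y w"
      using word_value_transfer[OF x y sq _ w] v by blast
    finally show ?thesis .
  qed
  have hom: "\<alpha> \<in> hom G G"
  proof (rule homI)
    fix u assume "u \<in> carrier G"
    then obtain w where "w \<in> ?W" "word_value G x w = u" using symplectic_generates[OF x] by blast
    then show "\<alpha> u \<in> carrier G" using \<alpha>[of w] word_value_closed[OF _ yf, of w] by simp
  next
    fix u u' assume "u \<in> carrier G" "u' \<in> carrier G"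
    then obtain w w' where w: "w \<in> ?W" "word_value G x w = u" "w' \<in> ?W" "word_value G x w' = u'"
      using symplectic_generates[OF x] by metis
    have "\<alpha> (word_value G x (w @ w')) = word_value G y (w @ w')" using w by (intro \<alpha>) simp
    then show "\<alpha> (u \<otimes> u') = \<alpha> u \<otimes> \<alpha> u'"
      using w \<alpha>[of w] \<alpha>[of w'] by (simp add: word_value_append[OF _ _ xf] word_value_append[OF _ _ yf])
  qed
  have surj: "carrier G \<subseteq> \<alpha> ` carrier G"
  proof
    fix u assume "u \<in> carrier G"
    then obtain w where w: "w \<in> ?W" "word_value G y w = u" using symplectic_generates[OF y] by blast
    then show "u \<in> \<alpha> ` carrier G"
      using \<alpha>[OF w(1)] word_value_closed[OF w(1) xf] by (intro image_eqI[of _ _ "word_value G x w"]) auto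
  qed
  then have "\<alpha> ` carrier G = carrier G" using hom by (auto simp: hom_def)
  then have "bij_betw \<alpha> (carrier G) (carrier G)"
    using finite_carrier by (simp add: bij_betw_def finite_surj_inj)
  then have "\<alpha> \<in> auto G" using hom by (simp add: auto_def Bij_def \<alpha>_def)
  moreover have "\<alpha> (x j) = y j" if "j \<in> handle_gens n" for j
    using \<alpha>[of "[(j, True)]"] that symplectic_carrier[OF x that] symplectic_carrier[OF y that] by simp
  ultimately show ?thesis by blast
qed

lemma auto_image_symplectic:
  assumes \<alpha>: "\<alpha> \<in> auto G" and x: "symplectic n x"
  shows "symplectic n (\<lambda>j. \<alpha> (x j))" "square_set n (\<lambda>j. \<alpha> (x j)) = square_set n x"
proof -
  have hom: "\<alpha> \<in> hom G G" using \<alpha> by (simp add: auto_def)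
  interpret \<alpha>: group_hom G G \<alpha> using hom by (simp add: group_hom_def group_hom_axioms_def)
  have "anticommute (\<alpha> u) (\<alpha> v) \<longleftrightarrow> anticommute u v" if "u \<in> carrier G" "v \<in> carrier G" for u v
    using that auto_inject[OF \<alpha>, of "u \<otimes> v" "v \<otimes> u"] by (simp add: anticommute_def)
  then show "symplectic n (\<lambda>j. \<alpha> (x j))" using x by (auto simp: symplectic_def Pi_iff)
  have "nontrivial_square (\<alpha> u) \<longleftrightarrow> nontrivial_square u" if "u \<in> carrier G" for u
    using that auto_inject[OF \<alpha>, of "u \<otimes> u" \<one>] by (simp add: nontrivial_square_def)
  then show "square_set n (\<lambda>j. \<alpha> (x j)) = square_set n x"
    using symplectic_carrier[OF x] by (auto simp: square_set_def)
qed

lemma symplectic_restrict [simp]: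
  "symplectic n (restrict x (handle_gens n)) \<longleftrightarrow> symplectic n x"
  "square_set n (restrict x (handle_gens n)) = square_set n x"
  by (auto simp: symplectic_def square_set_def Pi_iff)

text \<open>The automorphism group acts simply transitively on the systems with a
  given square set.\<close>

lemma card_symplectic_given_squares:
  assumes x: "symplectic n x"
  shows "card {y \<in> handle_gens n \<rightarrow>\<^sub>E carrier G. symplectic n y \<and> square_set n y = square_set n x}
    = card (auto G)"
proof -
  let ?H = "handle_gens n"
  let ?B = "{y \<in> ?H \<rightarrow>\<^sub>E carrier G. symplectic n y \<and> square_set n y = square_set n x}"
  note xf = symplectic_funcset[OF x]
  have "bij_betw (\<lambda>\<alpha>. \<lambda>j\<in>?H. \<alpha> (x j)) (auto G) ?B"
    unfolding bij_betw_def
  proof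
    show "inj_on (\<lambda>\<alpha>. \<lambda>j\<in>?H. \<alpha> (x j)) (auto G)"
    proof (rule inj_onI)
      fix \<alpha> \<beta> assume ab: "\<alpha> \<in> auto G" "\<beta> \<in> auto G" "(\<lambda>j\<in>?H. \<alpha> (x j)) = (\<lambda>j\<in>?H. \<beta> (x j))"
      then have hom: "\<alpha> \<in> hom G G" "\<beta> \<in> hom G G" by (simp_all add: auto_def)
      have eq: "\<alpha> (x j) = \<beta> (x j)" if "j \<in> ?H" for j
        using fun_cong[OF ab(3), of j] that by simp
      show "\<alpha> = \<beta>"
      proof (rule extensionalityI[of _ "carrier G"])
        fix u assume "u \<in> carrier G"
        then obtain w where w: "w \<in> gwords ?H" "word_value G x w = u"
          using symplectic_generates[OF x] by blast
        have "\<alpha> u = word_value G (\<lambda>j. \<alpha> (x j)) w"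
          using hom_word_value[OF is_group hom(1) xf w(1)] w(2) by simp
        also have "\<dots> = word_value G (\<lambda>j. \<beta> (x j)) w"
          using eq by (rule word_value_cong[OF w(1)])
        also have "\<dots> = \<beta> u" using hom_word_value[OF is_group hom(2) xf w(1)] w(2) by simp
        finally show "\<alpha> u = \<beta> u" .
      qed (use ab in \<open>auto simp: auto_def Bij_def\<close>)
    qed
    show "(\<lambda>\<alpha>. \<lambda>j\<in>?H. \<alpha> (x j)) ` auto G = ?B"
    proof
      show "(\<lambda>\<alpha>. \<lambda>j\<in>?H. \<alpha> (x j)) ` auto G \<subseteq> ?B"
      proof (rule image_subsetI)
        fix \<alpha> assume \<alpha>: "\<alpha> \<in> auto G"
        note sy = auto_image_symplectic[OF \<alpha> x]
        have "(\<lambda>j\<in>?H. \<alpha> (x j)) \<in> ?H \<rightarrow>\<^sub>E carrier G" using symplectic_funcset[OF sy(1)] by auto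
        then show "(\<lambda>j\<in>?H. \<alpha> (x j)) \<in> ?B" using sy by simp
      qed
      show "?B \<subseteq> (\<lambda>\<alpha>. \<lambda>j\<in>?H. \<alpha> (x j)) ` auto G"
      proof
        fix y assume y: "y \<in> ?B"
        then obtain \<alpha> where \<alpha>: "\<alpha> \<in> auto G" "\<forall>j\<in>?H. \<alpha> (x j) = y j"
          using automorphism_extending[OF x, of y] by auto
        have "y = (\<lambda>j\<in>?H. \<alpha> (x j))"
          using y \<alpha>(2) by (intro extensionalityI[of _ ?H]) (auto simp: PiE_iff)
        then show "y \<in> (\<lambda>\<alpha>. \<lambda>j\<in>?H. \<alpha> (x j)) ` auto G" using \<alpha>(1) by blast
      qed
    qed
  qed
  then show ?thesis by (rule bij_betw_same_card[symmetric])
qed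

lemma card_symplectic:
  assumes x: "symplectic n x"
  shows "card {y \<in> handle_gens n \<rightarrow>\<^sub>E carrier G. symplectic n y}
    = card {E \<in> Pow (handle_gens n). arf n E = arf n (square_set n x)} * card (auto G)"
proof -
  let ?H = "handle_gens n" and ?S = "{E \<in> Pow (handle_gens n). arf n E = arf n (square_set n x)}"
  let ?B = "\<lambda>E. {y \<in> ?H \<rightarrow>\<^sub>E carrier G. symplectic n y \<and> square_set n y = E}"
  have "{y \<in> ?H \<rightarrow>\<^sub>E carrier G. symplectic n y} = (\<Union>E\<in>?S. ?B E)"
    using arf_square_set_unique[OF _ x] by (auto simp: square_set_def)
  moreover have "card (\<Union>E\<in>?S. ?B E) = (\<Sum>E\<in>?S. card (?B E))"
  proof (rule card_UN_disjoint)
    have "finite (?H \<rightarrow>\<^sub>E carrier G)" using finite_carrier by (simp add: finite_PiE)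
    then show "\<forall>E\<in>?S. finite (?B E)" by (intro ballI) simp
    show "finite ?S" by simp
    show "\<forall>E\<in>?S. \<forall>F\<in>?S. E \<noteq> F \<longrightarrow> ?B E \<inter> ?B F = {}" by fast
  qed
  moreover have "card (?B E) = card (auto G)" if "E \<in> ?S" for E
  proof -
    have E: "E \<subseteq> handle_gens n" "arf n E = arf n (square_set n x)"
      using that unfolding mem_Collect_eq Pow_iff by (rule conjunct1, rule conjunct2)
    obtain y where y: "symplectic n y" "square_set n y = E"
      using symplectic_transvection[OF x E] by blast
    show ?thesis using card_symplectic_given_squares[OF y(1)] unfolding y(2) .
  qed
  ultimately show ?thesis by (simp only: sum_constant of_nat_id cong: sum.cong)
qed

theorem card_symplectic_times_squares:
  "card {y \<in> handle_gens n \<rightarrow>\<^sub>E carrier G. symplectic n y} * card {s \<in> carrier G. nontrivial_square s}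
    = card (auto G) * (2 ^ (2 * n - 1) * (2 ^ (2 * n) - 1))"
proof -
  obtain x where x: "symplectic n x" using symplectic_exists by blast
  show ?thesis
    unfolding card_symplectic[OF x] card_nontrivial_squares[OF x]
      arf_counts_product[OF rank_pos, of "arf n (square_set n x)", symmetric]
    by (simp add: ac_simps)
qed

end

section \<open>Epimorphisms from the braid group\<close>

lemma braid_gens_eq: "braid_gens g = insert GenS (handle_gens g)"
  by (auto simp: braid_gens_def handle_gens_def)

lemma gwords_mono: "S \<subseteq> T \<Longrightarrow> w \<in> gwords S \<Longrightarrow> w \<in> gwords T"
  by (auto simp: gwords_def)

lemma gwords_concat: "(\<And>w. w \<in> set vs \<Longrightarrow> w \<in> gwords S) \<Longrightarrow> concat vs \<in> gwords S"
  by (induction vs) auto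

lemma gword_comm_in_gwords: "v \<in> gwords S \<Longrightarrow> w \<in> gwords S \<Longrightarrow> gword_comm v w \<in> gwords S"
  by (simp add: gword_comm_def gwords_inv)

lemma braid_rels_gwords:
  assumes "(r, s) \<in> braid_rels g"
  shows "r \<in> gwords (braid_gens g) \<and> s \<in> gwords (braid_gens g)"
proof -
  have "concat (map (\<lambda>i. gword_comm (wa i) (gword_inv (wb i))) [1..<Suc g]) \<in> gwords (braid_gens g)"
    by (rule gwords_concat)
      (auto simp: braid_gens_def intro!: gword_comm_in_gwords gwords_inv)
  then show ?thesis
    using assms unfolding braid_rels_def
    by (auto simp: braid_gens_def intro!: gword_comm_in_gwords)
qed

context extraspecial_two_group
begin

lemma word_value_comm:
  assumes "v \<in> gwords S" "w \<in> gwords S" "x \<in> S \<rightarrow> carrier G"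
  shows "word_value G x (gword_comm v w)
    = central_sign (anticommute (word_value G x v) (word_value G x w))"
proof -
  have c: "word_value G x v \<in> carrier G" "word_value G x w \<in> carrier G"
    using assms by (blast intro: word_value_closed)+
  have "word_value G x (gword_comm v w) = word_value G x v \<otimes> (word_value G x w
      \<otimes> (inv (word_value G x v) \<otimes> inv (word_value G x w)))"
    using assms by (simp add: gword_comm_def word_value_append[of _ S] gwords_inv word_value_gword_inv[of _ S])
  then show ?thesis using commutator_value[OF c] by simp
qed

lemma word_value_comm_conjugate:
  assumes x: "x \<in> braid_gens g \<rightarrow> carrier G" and "i \<in> handle_gens g" "j \<in> handle_gens g"
  shows "word_value G x (gword_comm [(i, True)] (ws' @ [(j, True)] @ [(GenS, e)]))
    = central_sign (anticommute (x i) (x j))"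
proof -
  have S: "[(i, True)] \<in> gwords (braid_gens g)"
      "ws' @ [(j, True)] @ [(GenS, e)] \<in> gwords (braid_gens g)"
    and c: "x i \<in> carrier G" "x j \<in> carrier G" "x GenS \<in> carrier G"
    using assms by (auto simp: braid_gens_eq)
  have "anticommute (x i) (word_value G x (ws' @ [(j, True)] @ [(GenS, e)]))
      \<longleftrightarrow> anticommute (x i) (x j)"
    using c by (cases e) (auto simp: anticommute_mult_right)
  then show ?thesis using word_value_comm[OF S x] c by simp
qed

end

context extraspecial_of_rank
begin

abbreviation satisfies_braid_rels :: "(braid_gen \<Rightarrow> 'a) \<Rightarrow> bool" where
  "satisfies_braid_rels x \<equiv> \<forall>(r, s)\<in>braid_rels n. word_value G x r = word_value G x s"

definition generating :: "(braid_gen \<Rightarrow> 'a) \<Rightarrow> bool" where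
  "generating x \<longleftrightarrow> (\<forall>y\<in>carrier G. \<exists>w\<in>gwords (braid_gens n). word_value G x w = y)"

text \<open>The conjugations by \<open>\<sigma>\<close> in the relations do not affect commutators, and squares
  and commutators are compared inside the centre.\<close>

lemma braid_rels_anticommute:
  assumes x: "x \<in> braid_gens n \<rightarrow> carrier G" and sat: "satisfies_braid_rels x"
    and i: "i \<in> handle_gens n" and j: "j \<in> handle_gens n"
  shows "anticommute (x i) (x j) \<longleftrightarrow> j = dual i \<and> nontrivial_square (x GenS)"
proof -
  have rel: "word_value G x r = word_value G x s" if "(r, s) \<in> braid_rels n" for r s
    using sat that by auto
  have s: "x GenS \<in> carrier G" using x by (auto simp: braid_gens_def)
  have gens: "GenA k \<in> handle_gens n" "GenB k \<in> handle_gens n" if "k \<in> {1..n}" for k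
    using that by (auto simp: handle_gens_def)
  note conj = word_value_comm_conjugate[OF x]
  have handle: "anticommute (x (GenA k)) (x (GenB k)) \<longleftrightarrow> nontrivial_square (x GenS)"
    if k: "k \<in> {1..n}" for k
  proof -
    have "(gword_comm (wa k) (ws' @ wb k @ ws'), ws @ ws) \<in> braid_rels n"
      using k unfolding braid_rels_def by blast
    from rel[OF this] show ?thesis
      using conj[OF gens(1)[OF k] gens(2)[OF k], of False] s square[OF s] by simp
  qed
  have less: "\<not> anticommute (x u) (x v)"
    if "k \<in> {1..n}" "l \<in> {1..<k}" "u = GenA k \<or> u = GenB k" "v = GenA l \<or> v = GenB l" for k l u v
  proof -
    have "(gword_comm [(u, True)] (ws' @ [(v, True)] @ ws), []) \<in> braid_rels n"
      using that unfolding braid_rels_def by blast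
    from rel[OF this]
    have "word_value G x (gword_comm [(u, True)] (ws' @ [(v, True)] @ ws)) = central_sign False"
      by (simp add: central_sign_def)
    moreover have "u \<in> handle_gens n" "v \<in> handle_gens n" using that by (auto simp: handle_gens_def)
    ultimately show ?thesis using conj[of u v True] by simp
  qed
  obtain k where k: "k \<in> {1..n}" "i = GenA k \<or> i = GenB k" using i by (auto simp: handle_gens_def)
  obtain l where l: "l \<in> {1..n}" "j = GenA l \<or> j = GenB l" using j by (auto simp: handle_gens_def)
  consider "l < k" | "k < l" | "k = l" by linarith
  then show ?thesis
  proof cases
    case 1
    then have "l \<in> {1..<k}" using l(1) by simp
    then show ?thesis using less[OF k(1) _ k(2) l(2)] 1 k(2) l(2) by auto
  next
    case 2
    then have "k \<in> {1..<l}" using k(1) by simp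
    then have "\<not> anticommute (x j) (x i)" using less[OF l(1) _ l(2) k(2)] by blast
    moreover have "j \<noteq> dual i" using 2 k(2) l(2) by auto
    ultimately show ?thesis using anticommute_sym[of "x i" "x j"] by blast
  next
    case 3
    have "anticommute (x (GenB k)) (x (GenA k)) \<longleftrightarrow> nontrivial_square (x GenS)"
      using handle[OF k(1)] anticommute_sym[of "x (GenB k)" "x (GenA k)"] by blast
    then show ?thesis using 3 k(2) l(2) handle[OF k(1)] by auto
  qed
qed

lemma word_value_surface_relator:
  assumes "x \<in> S \<rightarrow> carrier G"
    and "\<And>i. i \<in> set ks \<Longrightarrow> GenA i \<in> S \<and> GenB i \<in> S \<and> anticommute (x (GenA i)) (x (GenB i))"
  shows "word_value G x (concat (map (\<lambda>i. gword_comm (wa i) (gword_inv (wb i))) ks))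
    = central_sign (odd (length ks))"
  using assms(2)
proof (induction ks)
  case Nil
  show ?case by (simp add: central_sign_def)
next
  case (Cons i ks)
  let ?c = "\<lambda>i. gword_comm (wa i) (gword_inv (wb i))"
  have i: "wa i \<in> gwords S" "gword_inv (wb i) \<in> gwords S" "x (GenA i) \<in> carrier G" "x (GenB i) \<in> carrier G"
    using Cons.prems[of i] assms(1) by (auto intro: gwords_inv)
  have "word_value G x (?c i) = central_sign True"
    using word_value_comm[OF i(1,2) assms(1)] i Cons.prems[of i] by (simp add: gword_inv_def)
  moreover have "concat (map ?c ks) \<in> gwords S"
    using Cons.prems by (intro gwords_concat) (auto intro!: gword_comm_in_gwords gwords_inv)
  moreover have "?c i \<in> gwords S" using i by (intro gword_comm_in_gwords)
  moreover have "word_value G x (concat (map ?c ks)) = central_sign (odd (length ks))"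
    using Cons.prems by (intro Cons.IH) auto
  ultimately show ?case
    by (simp add: word_value_append[OF _ _ assms(1)] central_sign_mult)
qed

lemma symplectic_satisfies_braid_rels:
  assumes x: "x \<in> braid_gens n \<rightarrow> carrier G" and sy: "symplectic n x"
    and s: "nontrivial_square (x GenS)" and "odd n"
  shows "satisfies_braid_rels x"
proof -
  have sc: "x GenS \<in> carrier G" using x by (auto simp: braid_gens_def)
  have ss: "word_value G x (ws @ ws) = central_sign True" using sc s by (simp add: square)
  have nil: "word_value G x [] = central_sign False" by (simp add: central_sign_def)
  have val: "word_value G x (gword_comm [(i, True)] (ws' @ [(j, True)] @ [(GenS, e)]))
      = central_sign (j = dual i)"
    if "i \<in> handle_gens n" "j \<in> handle_gens n" for i j e
    using word_value_comm_conjugate[OF x that] sy that by (simp add: symplectic_def)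
  have gens: "GenA k \<in> handle_gens n" "GenB k \<in> handle_gens n" if "k \<in> {1..n}" for k
    using that by (auto simp: handle_gens_def)
  have surface: "word_value G x
      (concat (map (\<lambda>i. gword_comm (wa i) (gword_inv (wb i))) [1..<Suc n])) = central_sign True"
  proof (subst word_value_surface_relator[OF x])
    fix i assume "i \<in> set [1..<Suc n]"
    then have "i \<in> {1..n}" by auto
    then show "GenA i \<in> braid_gens n \<and> GenB i \<in> braid_gens n \<and> anticommute (x (GenA i)) (x (GenB i))"
      using gens[of i] sy by (simp add: braid_gens_eq symplectic_def)
  qed (use \<open>odd n\<close> rank_pos in simp)
  have "word_value G x r = word_value G x t" if "(r, t) \<in> braid_rels n" for r t
    using that unfolding braid_rels_def Un_iff UN_iff insert_iff empty_iff prod.inject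
    by (elim disjE bexE conjE)
      (simp_all only: val gens ss nil surface, auto simp: val[unfolded append.simps] gens)
  then show ?thesis by blast
qed

text \<open>If the surface generators commute with each other, then the form vanishes on
  all pairs of generators except those that involve \<open>\<sigma>\<close>, so its rank is at most two. In
  elementary terms: choose \<open>p\<close> with \<open>x p\<close> not commuting with \<open>\<sigma>\<close>, if there is one. An element that
  commutes with \<open>\<sigma>\<close> and \<open>x p\<close> commutes with all generators. So an element is determined up to a
  central factor by two bits, and \<open>G\<close> has at most eight elements.\<close>

lemma isotropic_not_generating:
  assumes x: "x \<in> braid_gens n \<rightarrow> carrier G" and gen: "generating x"
    and iso: "\<And>i j. i \<in> handle_gens n \<Longrightarrow> j \<in> handle_gens n \<Longrightarrow> \<not> anticommute (x i) (x j)"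
  shows "n \<le> 1"
proof -
  let ?s = "x GenS"
  have s: "?s \<in> carrier G" and xc: "\<And>j. j \<in> handle_gens n \<Longrightarrow> x j \<in> carrier G"
    using x by (auto simp: braid_gens_eq)
  have central: "\<not> anticommute y u"
    if "y \<in> carrier G" "u \<in> carrier G" "\<not> anticommute y ?s"
      "\<And>j. j \<in> handle_gens n \<Longrightarrow> \<not> anticommute y (x j)" for y u
  proof -
    obtain w where w: "w \<in> gwords (braid_gens n)" "word_value G x w = u"
      using gen \<open>u \<in> carrier G\<close> by (auto simp: generating_def)
    then show ?thesis
      using commutes_with_word[OF w(1) x \<open>y \<in> carrier G\<close>] that by (auto simp: braid_gens_eq)
  qed
  have "\<exists>p\<in>handle_gens n. \<forall>j\<in>handle_gens n. anticommute (x j) ?s \<longrightarrow> anticommute (x p) ?s"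
  proof (cases "\<exists>p\<in>handle_gens n. anticommute (x p) ?s")
    case False
    have "GenA 1 \<in> handle_gens n" using rank_pos by (simp add: handle_gens_def)
    with False show ?thesis by blast
  qed blast
  then obtain p where p: "p \<in> handle_gens n"
    and ps: "\<And>j. j \<in> handle_gens n \<Longrightarrow> anticommute (x j) ?s \<Longrightarrow> anticommute (x p) ?s" by blast
  have both: "\<exists>b. y = central_sign b"
    if y: "y \<in> carrier G" "\<not> anticommute y ?s" "\<not> anticommute y (x p)" for y
  proof -
    have "\<not> anticommute y (x j)" if j: "j \<in> handle_gens n" for j
    proof (cases "anticommute (x j) ?s")
      case True
      \<comment> \<open>The failures of \<open>x j\<close> and of \<open>x p\<close> to commute with \<open>\<sigma>\<close> cancel in the product.\<close>
      have "\<not> anticommute (x j \<otimes> x p) y"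
      proof (rule central)
        show "x j \<otimes> x p \<in> carrier G" using xc[OF j] xc[OF p] by simp
        show "\<not> anticommute (x j \<otimes> x p) ?s"
          using anticommute_mult_left[OF xc[OF j] xc[OF p] s] True ps[OF j True] by simp
        show "\<not> anticommute (x j \<otimes> x p) (x i)" if i: "i \<in> handle_gens n" for i
          using anticommute_mult_left[OF xc[OF j] xc[OF p] xc[OF i]] iso[OF j i] iso[OF p i] by simp
      qed (rule y(1))
      moreover have "\<not> anticommute (x p) y" using y(3) anticommute_sym[of "x p" y] by blast
      ultimately have "\<not> anticommute (x j) y"
        using anticommute_mult_left[OF xc[OF j] xc[OF p] y(1)] by simp
      then show ?thesis using anticommute_sym[of y "x j"] by blast
    next
      case False
      then have "\<not> anticommute (x j) y" using central[OF xc[OF j] y(1) _ iso[OF j]] by blast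
      then show ?thesis using anticommute_sym[of y "x j"] by blast
    qed
    then have "\<forall>u\<in>carrier G. \<not> anticommute y u" using central[OF y(1) _ y(2)] by blast
    then show ?thesis by (rule iffD1[OF central_iff_sign[OF y(1)]])
  qed
  define \<phi> where "\<phi> y = (anticommute y ?s, anticommute y (x p))" for y
  have fibre: "card {y \<in> carrier G. \<phi> y = v} \<le> 2" for v
  proof (cases "\<exists>u\<in>carrier G. \<phi> u = v")
    case True
    then obtain u where u: "u \<in> carrier G" "\<phi> u = v" by blast
    have "{y \<in> carrier G. \<phi> y = v} \<subseteq> (\<lambda>b. central_sign b \<otimes> u) ` UNIV"
    proof
      fix y assume "y \<in> {y \<in> carrier G. \<phi> y = v}"
      then have y: "y \<in> carrier G" "\<phi> y = \<phi> u" using u(2) by auto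
      then have "\<not> anticommute (y \<otimes> inv u) ?s" "\<not> anticommute (y \<otimes> inv u) (x p)"
        using u(1) s xc[OF p] by (auto simp: \<phi>_def anticommute_mult_left)
      then obtain b where "y \<otimes> inv u = central_sign b" using both[of "y \<otimes> inv u"] y u by auto
      moreover have "y = (y \<otimes> inv u) \<otimes> u" using y(1) u(1) by (simp add: m_assoc)
      ultimately have "y = central_sign b \<otimes> u" by simp
      then show "y \<in> (\<lambda>b. central_sign b \<otimes> u) ` UNIV" by blast
    qed
    then have "card {y \<in> carrier G. \<phi> y = v} \<le> card ((\<lambda>b. central_sign b \<otimes> u) ` UNIV)"
      by (rule card_mono[rotated]) simp
    also have "\<dots> \<le> card (UNIV :: bool set)" by (rule card_image_le) simp
    finally show ?thesis by simp
  next
    case False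
    then have none: "{y \<in> carrier G. \<phi> y = v} = {}" by blast
    show ?thesis unfolding none by simp
  qed
  have "carrier G = (\<Union>v\<in>UNIV. {y \<in> carrier G. \<phi> y = v})" by blast
  then have "order G \<le> (\<Sum>v\<in>UNIV. card {y \<in> carrier G. \<phi> y = v})"
    unfolding order_def using card_UN_le[of UNIV "\<lambda>v. {y \<in> carrier G. \<phi> y = v}"] by simp
  also have "\<dots> \<le> of_nat (card (UNIV :: (bool \<times> bool) set)) * 2" by (rule sum_bounded_above) (rule fibre)
  also have "\<dots> = 8" by (simp add: card_UNIV_bool flip: UNIV_Times_UNIV)
  finally have "4 ^ n \<le> (4::nat) ^ 1" by (simp add: order_eq_four_power)
  then show ?thesis by (rule power_le_imp_le_exp[rotated]) simp
qed

lemma epi_conditions_iff: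
  assumes x: "x \<in> braid_gens n \<rightarrow> carrier G" and n: "odd n" "n \<ge> 3"
  shows "satisfies_braid_rels x \<and> generating x \<and> x GenS \<noteq> \<one>
    \<longleftrightarrow> symplectic n x \<and> nontrivial_square (x GenS)"
proof
  assume a: "satisfies_braid_rels x \<and> generating x \<and> x GenS \<noteq> \<one>"
  then have sat: "satisfies_braid_rels x" and gen: "generating x" by blast+
  have rel: "anticommute (x i) (x j) \<longleftrightarrow> j = dual i \<and> nontrivial_square (x GenS)"
    if "i \<in> handle_gens n" "j \<in> handle_gens n" for i j
    using x sat that by (rule braid_rels_anticommute)
  have "nontrivial_square (x GenS)"
  proof (rule ccontr)
    assume "\<not> nontrivial_square (x GenS)"
    then have "n \<le> 1" using rel by (intro isotropic_not_generating[OF x gen]) auto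
    then show False using n by simp
  qed
  moreover from this have "symplectic n x"
    using rel x by (auto simp: symplectic_def braid_gens_eq)
  ultimately show "symplectic n x \<and> nontrivial_square (x GenS)" by blast
next
  assume a: "symplectic n x \<and> nontrivial_square (x GenS)"
  then have "satisfies_braid_rels x" using symplectic_satisfies_braid_rels[OF x] n by blast
  moreover have "generating x"
    unfolding generating_def
  proof
    fix y assume "y \<in> carrier G"
    then obtain w where "w \<in> gwords (handle_gens n)" "word_value G x w = y"
      using symplectic_generates a by blast
    then show "\<exists>w\<in>gwords (braid_gens n). word_value G x w = y"
      using gwords_mono[of "handle_gens n" "braid_gens n" w] by (auto simp: braid_gens_eq)
  qed
  moreover have "x GenS \<noteq> \<one>" using a by (auto simp: nontrivial_square_def)
  ultimately show "satisfies_braid_rels x \<and> generating x \<and> x GenS \<noteq> \<one>" by blast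
qed

end

lemma (in group) ord_ge_two_iff:
  assumes "finite (carrier G)" "x \<in> carrier G"
  shows "ord x \<ge> 2 \<longleftrightarrow> x \<noteq> \<one>"
  using ord_ge_1[OF assms] ord_eq_1[OF assms(2)] by linarith

context extraspecial_of_rank
begin

text \<open>Evaluation at the generators turns admissible epimorphisms into lifted symplectic
  bases with a marked element of order four.\<close>

lemma bij_betw_admissible_epis:
  assumes n: "odd n" "n \<ge> 3"
  shows "bij_betw (\<lambda>f. \<lambda>s\<in>braid_gens n. f (pres_class (braid_gens n) (braid_rels n) [(s, True)]))
    (admissible_epis n G)
    {x \<in> braid_gens n \<rightarrow>\<^sub>E carrier G. symplectic n x \<and> nontrivial_square (x GenS)}"
    (is "bij_betw ?ev _ ?Y")
proof -
  let ?S = "braid_gens n" and ?R = "braid_rels n"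
  let ?F = "hom (braid2 n) G \<inter> extensional (carrier (braid2 n))"
  let ?X = "{x \<in> ?S \<rightarrow>\<^sub>E carrier G. satisfies_braid_rels x}"
  have bij: "bij_betw ?ev ?F ?X"
    unfolding braid2_def using bij_betw_hom_presented_group[OF braid_rels_gwords] .
  have sub: "admissible_epis n G \<subseteq> ?F" by (auto simp: admissible_epis_def epi_def)
  have adm: "f \<in> admissible_epis n G \<longleftrightarrow> generating (?ev f) \<and> ?ev f GenS \<noteq> \<one>" if f: "f \<in> ?F" for f
  proof -
    have val: "word_value G (?ev f) w = f (pres_class ?S ?R w)" if w: "w \<in> gwords ?S" for w
    proof -
      have "f \<in> hom (presented_group ?S ?R) G" using f by (simp add: braid2_def)
      note hom_presented_group_value[OF this w]
      also have "word_value G (\<lambda>s. f (pres_class ?S ?R [(s, True)])) w = word_value G (?ev f) w"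
        by (rule word_value_cong[OF w]) simp
      finally show ?thesis by simp
    qed
    have "f ` carrier (braid2 n) = word_value G (?ev f) ` gwords ?S"
      using val by (auto simp: braid2_def presented_group_carrier image_image)
    moreover have "f ` carrier (braid2 n) \<subseteq> carrier G" using f by (auto simp: hom_def)
    ultimately have "f ` carrier (braid2 n) = carrier G
        \<longleftrightarrow> carrier G \<subseteq> word_value G (?ev f) ` gwords ?S" by blast
    moreover have "A \<subseteq> h ` B \<longleftrightarrow> (\<forall>y\<in>A. \<exists>w\<in>B. h w = y)"
      for A :: "'a set" and B :: "braid_gen gword set" and h by auto
    ultimately have gen: "f ` carrier (braid2 n) = carrier G \<longleftrightarrow> generating (?ev f)"
      by (simp only: generating_def)
    have sig: "?ev f GenS = f (braid2_sigma n)" by (simp add: braid2_sigma_def braid_gens_eq)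
    have "braid2_sigma n \<in> carrier (braid2 n)"
      unfolding braid2_sigma_def braid2_def by (rule pres_class_in_carrier) (simp add: braid_gens_eq)
    then have "f (braid2_sigma n) \<in> carrier G" using f by (auto simp: hom_def)
    then show ?thesis
      unfolding sig using f gen by (simp add: admissible_epis_def epi_def ord_ge_two_iff finite_carrier)
  qed
  have "?ev ` admissible_epis n G = ?Y"
  proof
    show "?ev ` admissible_epis n G \<subseteq> ?Y"
    proof (rule image_subsetI)
      fix f assume f: "f \<in> admissible_epis n G"
      then have "?ev f \<in> ?X" using sub bij by (blast dest: bij_betwE)
      moreover from this have "?ev f \<in> ?S \<rightarrow> carrier G" by auto
      moreover have "generating (?ev f) \<and> ?ev f GenS \<noteq> \<one>" using adm[of f] f sub by blast
      ultimately show "?ev f \<in> ?Y" using epi_conditions_iff[of "?ev f"] n by blast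
    qed
    show "?Y \<subseteq> ?ev ` admissible_epis n G"
    proof
      fix x assume x: "x \<in> ?Y"
      then have "x \<in> ?S \<rightarrow> carrier G" by auto
      then have sat: "satisfies_braid_rels x \<and> generating x \<and> x GenS \<noteq> \<one>"
        using epi_conditions_iff[of x] n x by blast
      then have "x \<in> ?X" using x by blast
      then obtain f where f: "f \<in> ?F" "x = ?ev f"
        using bij unfolding bij_betw_def by blast
      then show "x \<in> ?ev ` admissible_epis n G" using adm[OF f(1)] sat by blast
    qed
  qed
  moreover have "inj_on ?ev (admissible_epis n G)"
    using bij sub by (auto simp: bij_betw_def intro: inj_on_subset)
  ultimately show ?thesis by (simp add: bij_betw_def)
qed

lemma card_marked_systems:
  "card {x \<in> braid_gens n \<rightarrow>\<^sub>E carrier G. symplectic n x \<and> nontrivial_square (x GenS)}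
    = card {s \<in> carrier G. nontrivial_square s} * card {y \<in> handle_gens n \<rightarrow>\<^sub>E carrier G. symplectic n y}"
proof -
  let ?Q = "{s \<in> carrier G. nontrivial_square s}"
    and ?B = "{y \<in> handle_gens n \<rightarrow>\<^sub>E carrier G. symplectic n y}"
  let ?join = "\<lambda>(s, y). y(GenS := s)"
  have new: "GenS \<notin> handle_gens n" by (auto simp: handle_gens_def)
  have upd: "symplectic n (y(GenS := s)) \<longleftrightarrow> symplectic n y" for y s
  proof -
    have "(y(GenS := s)) j = y j" if "j \<in> handle_gens n" for j using new that by auto
    then show ?thesis by (simp add: symplectic_def Pi_iff cong: ball_cong)
  qed
  have "{x \<in> braid_gens n \<rightarrow>\<^sub>E carrier G. symplectic n x \<and> nontrivial_square (x GenS)} = ?join ` (?Q \<times> ?B)"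
    unfolding braid_gens_eq PiE_insert_eq by (auto simp: upd image_iff)
  moreover have "inj_on ?join (?Q \<times> ?B)"
    by (rule inj_on_subset[OF inj_combinator[OF new, of "\<lambda>_. carrier G"]]) auto
  ultimately show ?thesis by (simp add: card_image card_cartesian_product)
qed

lemma num_admissible_eq:
  assumes n: "odd n" "n \<ge> 3"
  shows "num_admissible n G = card (auto G) * (2 ^ (2 * n - 1) * (2 ^ (2 * n) - 1))"
  unfolding num_admissible_def bij_betw_same_card[OF bij_betw_admissible_epis[OF n]]
    card_marked_systems card_symplectic_times_squares[symmetric] by (rule mult.commute)

lemma finite_admissible_epis:
  assumes n: "odd n" "n \<ge> 3"
  shows "finite (admissible_epis n G)"
proof -
  have "finite (braid_gens n \<rightarrow>\<^sub>E carrier G)"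
    using finite_carrier by (intro finite_PiE) (auto simp: braid_gens_eq)
  then show ?thesis using bij_betw_finite[OF bij_betw_admissible_epis[OF n]] by simp
qed

end

section \<open>Orbits under automorphisms\<close>

context
  fixes G :: "'a monoid" (structure)
  assumes group_G: "group G"
begin

interpretation group G by (rule group_G)

lemma compose_admissible:
  assumes fin: "finite (carrier G)" and \<alpha>: "\<alpha> \<in> auto G" and f: "f \<in> admissible_epis g G"
  shows "compose (carrier (braid2 g)) \<alpha> f \<in> admissible_epis g G"
proof -
  let ?C = "carrier (braid2 g)"
  have \<alpha>': "\<alpha> \<in> hom G G" "inj_on \<alpha> (carrier G)" "\<alpha> ` carrier G = carrier G"
    using \<alpha> by (auto simp: auto_def Bij_def bij_betw_def)
  have f': "f \<in> hom (braid2 g) G" "f ` ?C = carrier G" "ord (f (braid2_sigma g)) \<ge> 2"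
    using f by (auto simp: admissible_epis_def epi_def)
  have grp: "group (braid2 g)" by (simp add: braid2_def group_presented_group)
  have sig: "braid2_sigma g \<in> ?C"
    unfolding braid2_sigma_def braid2_def by (rule pres_class_in_carrier) (simp add: braid_gens_eq)
  have "compose ?C \<alpha> f \<in> hom (braid2 g) G"
    using f'(1) \<alpha>'(1) by (rule group.hom_compose[OF grp])
  moreover have "compose ?C \<alpha> f ` ?C = carrier G"
    using f'(2) \<alpha>'(3) by (metis surj_compose)
  moreover have "ord (compose ?C \<alpha> f (braid2_sigma g)) \<ge> 2"
  proof -
    have s: "f (braid2_sigma g) \<in> carrier G" using sig f'(2) by blast
    have "f (braid2_sigma g) \<noteq> \<one>" using f'(3) ord_ge_two_iff[OF fin s] by simp
    then have "\<alpha> (f (braid2_sigma g)) \<noteq> \<one>"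
      using \<alpha>'(2) s hom_one[OF \<alpha>'(1) is_group is_group] by (metis inj_onD one_closed)
    moreover have "\<alpha> (f (braid2_sigma g)) \<in> carrier G" using s \<alpha>'(3) by blast
    ultimately show ?thesis using ord_ge_two_iff[OF fin] sig by (simp add: compose_eq)
  qed
  ultimately show ?thesis by (simp add: admissible_epis_def epi_def)
qed

lemma compose_admissible_inject:
  assumes \<alpha>: "\<alpha> \<in> auto G" and f: "f \<in> admissible_epis g G" "h \<in> admissible_epis g G"
    and eq: "compose (carrier (braid2 g)) \<alpha> f = compose (carrier (braid2 g)) \<alpha> h"
  shows "f = h"
proof (rule extensionalityI[of _ "carrier (braid2 g)"])
  fix c assume c: "c \<in> carrier (braid2 g)"
  then have "\<alpha> (f c) = \<alpha> (h c)" using fun_cong[OF eq, of c] by (simp add: compose_eq)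
  moreover have "f c \<in> carrier G" "h c \<in> carrier G"
    using f c by (auto simp: admissible_epis_def epi_def hom_def)
  ultimately show "f c = h c"
    using \<alpha> by (auto simp: auto_def Bij_def bij_betw_def inj_on_def)
qed (use f in \<open>auto simp: admissible_epis_def\<close>)

lemma group_action_post_compose:
  assumes fin: "finite (carrier G)" "finite (admissible_epis g G)"
  shows "group_action (AutoGroup G) (admissible_epis g G) (post_compose g G)"
proof -
  let ?E = "admissible_epis g G" and ?C = "carrier (braid2 g)"
  have carr: "carrier (AutoGroup G) = auto G" by (simp add: AutoGroup_def)
  have Bij: "post_compose g G \<alpha> \<in> Bij ?E" if \<alpha>: "\<alpha> \<in> auto G" for \<alpha>
  proof -
    have "inj_on (post_compose g G \<alpha>) ?E"
      using compose_admissible_inject[OF \<alpha>] by (auto simp: inj_on_def post_compose_def)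
    moreover have "post_compose g G \<alpha> ` ?E \<subseteq> ?E"
      using compose_admissible[OF fin(1) \<alpha>] by (auto simp: post_compose_def)
    ultimately show ?thesis
      using endo_inj_surj[OF fin(2)] by (auto simp: Bij_def bij_betw_def post_compose_def)
  qed
  have "post_compose g G (\<alpha> \<otimes>\<^bsub>AutoGroup G\<^esub> \<beta>)
      = post_compose g G \<alpha> \<otimes>\<^bsub>BijGroup ?E\<^esub> post_compose g G \<beta>"
    if ab: "\<alpha> \<in> auto G" "\<beta> \<in> auto G" for \<alpha> \<beta>
  proof -
    have "\<alpha> \<otimes>\<^bsub>AutoGroup G\<^esub> \<beta> = compose (carrier G) \<alpha> \<beta>"
      using ab by (simp add: AutoGroup_def BijGroup_def auto_def)
    moreover have "compose ?C (compose (carrier G) \<alpha> \<beta>) f = compose ?C \<alpha> (compose ?C \<beta> f)"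
      if "f \<in> ?E" for f
      using that by (intro compose_assoc[symmetric]) (auto simp: admissible_epis_def epi_def hom_def)
    ultimately show ?thesis
      using Bij[OF ab(1)] Bij[OF ab(2)] compose_admissible[OF fin(1) ab(2)]
      by (auto simp: BijGroup_def post_compose_def compose_def fun_eq_iff)
  qed
  then have "post_compose g G \<in> hom (AutoGroup G) (BijGroup ?E)"
    using Bij by (intro homI) (auto simp: carr, simp add: BijGroup_def)
  then show ?thesis
    by (simp add: group_action_def group_hom_def group_hom_axioms_def AutoGroup group_BijGroup)
qed

text \<open>The action is free, because an epimorphism is surjective: two automorphisms that
  agree after composition with it agree on all of \<open>G\<close>. So every orbit has \<open>|Aut G|\<close> elements.\<close>

lemma num_admissible_orbits:
  assumes fin: "finite (carrier G)" "finite (admissible_epis g G)"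
  shows "num_admissible g G = order (AutoGroup G) * num_admissible_upto_aut g G"
proof -
  let ?E = "admissible_epis g G" and ?\<phi> = "post_compose g G" and ?A = "AutoGroup G"
  interpret action: group_action ?A ?E ?\<phi> by (rule group_action_post_compose[OF fin])
  have carr: "carrier ?A = auto G" by (simp add: AutoGroup_def)
  have orb: "card (orbit ?A ?\<phi> f) = order ?A" if f: "f \<in> ?E" for f
  proof -
    have "inj_on (\<lambda>\<alpha>. ?\<phi> \<alpha> f) (auto G)"
    proof (rule inj_onI)
      fix \<alpha> \<beta> assume ab: "\<alpha> \<in> auto G" "\<beta> \<in> auto G" "?\<phi> \<alpha> f = ?\<phi> \<beta> f"
      show "\<alpha> = \<beta>"
      proof (rule extensionalityI[of _ "carrier G"])
        fix u assume "u \<in> carrier G"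
        then have "u \<in> f ` carrier (braid2 g)"
          using f by (simp add: admissible_epis_def epi_def)
        then obtain c where c: "u = f c" "c \<in> carrier (braid2 g)" by (rule imageE)
        have "compose (carrier (braid2 g)) \<alpha> f c = compose (carrier (braid2 g)) \<beta> f c"
          using ab(3) f by (simp add: post_compose_def)
        then show "\<alpha> u = \<beta> u" using c by (simp add: compose_eq)
      qed (use ab in \<open>auto simp: auto_def Bij_def\<close>)
    qed
    moreover have "orbit ?A ?\<phi> f = (\<lambda>\<alpha>. ?\<phi> \<alpha> f) ` auto G"
      by (auto simp: orbit_def carr)
    ultimately show ?thesis by (simp add: card_image order_def carr)
  qed
  have "order ?A * card (orbits ?A ?E ?\<phi>) = card (\<Union> (orbits ?A ?E ?\<phi>))"
  proof (rule card_partition)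
    show "finite (orbits ?A ?E ?\<phi>)" using fin(2) by (simp add: orbits_def setcompr_eq_image)
    show "finite (\<Union> (orbits ?A ?E ?\<phi>))" using fin(2) by (simp add: action.orbits_coverture)
    show "card U = order ?A" if "U \<in> orbits ?A ?E ?\<phi>" for U using that orb by (auto simp: orbits_def)
    show "U \<inter> V = {}" if "U \<in> orbits ?A ?E ?\<phi>" "V \<in> orbits ?A ?E ?\<phi>" "U \<noteq> V" for U V
      using action.disjoint_union[OF that(1,2)] that(3) by blast
  qed
  then show ?thesis
    by (simp add: num_admissible_def num_admissible_upto_aut_def action.orbits_coverture)
qed

lemma order_AutoGroup_pos:
  assumes "finite (carrier G)"
  shows "order (AutoGroup G) > 0"
proof -
  have "auto G \<subseteq> carrier G \<rightarrow>\<^sub>E carrier G" unfolding PiE_def by (auto simp: auto_def hom_def Bij_def)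
  moreover have "finite (carrier G \<rightarrow>\<^sub>E carrier G)" using assms by (intro finite_PiE)
  ultimately have "finite (auto G)" by (rule finite_subset)
  then show ?thesis using id_in_auto by (auto simp: order_def AutoGroup_def card_gt_0_iff)
qed

end

section \<open>Extra-special groups\<close>

text \<open>The order of \<open>G\<close> forces the prime to be two. Commutators and squares lie in the
  centre because the quotient by the centre is abelian of exponent two.\<close>

lemma extra_special_two_group:
  fixes G :: "'a monoid" (structure)
  assumes "extra_special G" and ord: "order G = 2 ^ (2 * n + 1)" and "n \<ge> 1"
  shows "\<exists>z. extraspecial_of_rank G z n"
proof -
  obtain p where p: "Factorial_Ring.prime p" "finite_p_group p G" "card (center G) = p"
      "elementary_abelian p (G Mod center G)"
    using assms(1) by (auto simp: extra_special_def)
  then interpret group G by (simp add: finite_p_group_def)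
  have fin: "finite (carrier G)" using p(2) by (simp add: finite_p_group_def)
  obtain k where k: "order G = p ^ k" using p(2) by (auto simp: finite_p_group_def)
  have "Factorial_Ring.prime (2::nat)" by (rule two_is_prime_nat)
  moreover have "(2::nat) dvd p ^ k" using ord k by simp
  ultimately have "(2::nat) dvd p" by (rule prime_dvd_power)
  then have p2: "p = 2" using p(1) \<open>Factorial_Ring.prime (2::nat)\<close> by (metis primes_dvd_imp_eq)
  have cen: "\<one> \<in> center G" by (simp add: center_def)
  have cc: "center G \<subseteq> carrier G" by (auto simp: center_def)
  have "card (center G) = 2" using p(3) p2 by simp
  then have "card (center G - {\<one>}) = 1" using cen by simp
  then obtain z where "center G - {\<one>} = {z}" by (auto simp: card_1_singleton_iff)
  then have z: "center G = {\<one>, z}" "z \<noteq> \<one>" using cen by auto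
  have zc: "z \<in> carrier G" using z(1) cc by auto
  have sub: "subgroup (center G) G"
  proof (rule subgroupI)
    show "center G \<subseteq> carrier G" by (rule cc)
    show "center G \<noteq> {}" using cen by blast
    fix a assume a: "a \<in> center G"
    show "inv a \<in> center G"
      unfolding center_def
    proof (clarify, intro conjI ballI)
      show "inv a \<in> carrier G" using a cc by auto
      fix x assume x: "x \<in> carrier G"
      have "a \<in> carrier G" "a \<otimes> x = x \<otimes> a" using a x by (auto simp: center_def)
      then show "inv a \<otimes> x = x \<otimes> inv a"
        using x by (metis inv_closed inv_solve_left inv_solve_right m_assoc m_closed)
    qed
    fix b assume b: "b \<in> center G"
    show "a \<otimes> b \<in> center G"
      unfolding center_def
    proof (clarify, intro conjI ballI)
      have ab: "a \<in> carrier G" "b \<in> carrier G" using a b cc by auto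
      then show "a \<otimes> b \<in> carrier G" by simp
      fix x assume x: "x \<in> carrier G"
      have comm: "a \<otimes> x = x \<otimes> a" "b \<otimes> x = x \<otimes> b" using a b x by (auto simp: center_def)
      have "a \<otimes> b \<otimes> x = a \<otimes> x \<otimes> b" using ab x by (simp add: m_assoc comm(2))
      then show "a \<otimes> b \<otimes> x = x \<otimes> (a \<otimes> b)" using ab x by (simp add: m_assoc comm(1))
    qed
  qed
  have coset: "x \<in> {y, z \<otimes> y}" if "center G #> x = center G #> y" "x \<in> carrier G" "y \<in> carrier G" for x y
  proof -
    have "x \<in> center G #> y" using that sub by (metis rcos_self)
    then show ?thesis using that z(1) by (auto simp: r_coset_def)
  qed
  have nor: "center G \<lhd> G"
  proof (rule normalI[OF sub], intro ballI)
    fix x assume "x \<in> carrier G"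
    then have "h \<otimes> x = x \<otimes> h" if "h \<in> center G" for h using that by (simp add: center_def)
    then show "center G #> x = x <# center G" by (simp add: r_coset_def l_coset_def)
  qed
  interpret N: normal "center G" G by (rule nor)
  let ?Q = "G Mod center G"
  have comm: "comm_group ?Q" and sq: "\<And>C. C \<in> carrier ?Q \<Longrightarrow> C [^]\<^bsub>?Q\<^esub> (2::nat) = \<one>\<^bsub>?Q\<^esub>"
    using p(4) p2 by (auto simp: elementary_abelian_def)
  interpret Q: comm_group ?Q by (rule comm)
  have inQ: "center G #> x \<in> carrier ?Q" if "x \<in> carrier G" for x
    using that by (auto simp: carrier_FactGroup)
  have mulQ: "(center G #> x) \<otimes>\<^bsub>?Q\<^esub> (center G #> y) = center G #> (x \<otimes> y)"
    if "x \<in> carrier G" "y \<in> carrier G" for x y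
    using that by (simp add: N.rcos_sum)
  have "x \<otimes> x \<in> {\<one>, z}" if x: "x \<in> carrier G" for x
  proof -
    have "center G #> (x \<otimes> x) = (center G #> x) \<otimes>\<^bsub>?Q\<^esub> (center G #> x)"
      by (rule mulQ[OF x x, symmetric])
    also have "\<dots> = (center G #> x) [^]\<^bsub>?Q\<^esub> (2::nat)"
      by (simp only: numeral_2_eq_2 Q.nat_pow_Suc Q.nat_pow_0 Q.l_one[OF inQ[OF x]])
    also have "\<dots> = \<one>\<^bsub>?Q\<^esub>" by (rule sq[OF inQ[OF x]])
    finally have "center G #> (x \<otimes> x) = center G #> \<one>" using cc by (simp add: coset_mult_one)
    then show ?thesis using coset[of "x \<otimes> x" \<one>] x zc by simp
  qed
  moreover have "x \<otimes> y = y \<otimes> x \<or> x \<otimes> y = z \<otimes> (y \<otimes> x)"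
    if xy: "x \<in> carrier G" "y \<in> carrier G" for x y
  proof -
    have "center G #> (x \<otimes> y) = center G #> (y \<otimes> x)"
      using Q.m_comm[OF inQ inQ, OF xy] xy by (simp only: mulQ)
    then show ?thesis using coset[of "x \<otimes> y" "y \<otimes> x"] xy by simp
  qed
  ultimately have "extraspecial_of_rank G z n"
    using fin z ord assms(3) by unfold_locales auto
  then show ?thesis by blast
qed

lemma extra_special_counts:
  fixes G :: "'a monoid"
  assumes "extra_special G" "order G = 2 ^ (2 * n + 1)" "n \<ge> 3" "odd n"
  shows "num_admissible n G = order (AutoGroup G) * num_admissible_upto_aut n G"
    and "num_admissible_upto_aut n G = 2 ^ (2 * n - 1) * (2 ^ (2 * n) - 1)"
    and "order (AutoGroup G) > 0"
proof -
  obtain z where "extraspecial_of_rank G z n"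
    using extra_special_two_group[OF assms(1,2)] assms(3) by auto
  then interpret extraspecial_of_rank G z n .
  show 1: "num_admissible n G = order (AutoGroup G) * num_admissible_upto_aut n G"
    by (rule num_admissible_orbits[OF is_group finite_carrier finite_admissible_epis[OF assms(4,3)]])
  show 2: "order (AutoGroup G) > 0" by (rule order_AutoGroup_pos[OF is_group finite_carrier])
  have "order (AutoGroup G) = card (auto G)" by (simp add: order_def AutoGroup_def)
  then show "num_admissible_upto_aut n G = 2 ^ (2 * n - 1) * (2 ^ (2 * n) - 1)"
    using 1 2 num_admissible_eq[OF assms(4,3)] by simp
qed

theorem corollary6p17:
  fixes g :: nat and G :: "'a monoid" and H :: "'b monoid"
  assumes "g \<ge> 3" and "odd g"
    and "extra_special G" and "order G = 2 ^ (2 * g + 1)"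
  shows "real (num_admissible_upto_aut g G)
           = 1 / real (order (AutoGroup G)) * real (num_admissible g G)
       \<and> num_admissible_upto_aut g G = 2 ^ (2 * g - 1) * (2 ^ (2 * g) - 1)
       \<and> (extra_special H \<and> order H = 2 ^ (2 * g + 1)
            \<longrightarrow> num_admissible_upto_aut g H = num_admissible_upto_aut g G)"
proof (intro conjI impI)
  note G = extra_special_counts[OF assms(3,4,1,2)]
  show "real (num_admissible_upto_aut g G)
      = 1 / real (order (AutoGroup G)) * real (num_admissible g G)"
    using G(3) by (simp add: G(1))
  show "num_admissible_upto_aut g G = 2 ^ (2 * g - 1) * (2 ^ (2 * g) - 1)" by (rule G(2))
  assume "extra_special H \<and> order H = 2 ^ (2 * g + 1)"
  then show "num_admissible_upto_aut g H = num_admissible_upto_aut g G"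
    using extra_special_counts(2)[of H g] assms(1,2) G(2) by simp
qed

end
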